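(* Let $(G,m,u,\iota)$ be a group object in a Cartesian tangent category such that the pullback $T(G)_u$ of $p_G:T(G)\to G$ along $u:1\to G$ exists and is preserved by $T$. Let $\phi=\langle p,\langle !,\langle p\iota0,1\rangle T(m)\rangle\rangle:T(G)\to G\times T(G)_u$, an isomorphism with inverse $(0\times p_u^* )T(m)$. Then $$\phi^{-1}\,\ell_G\,T(\phi)\,(\phi\times\langle p,\{1\}\rangle)=\langle\pi_0,\,!0_u,\,!0_u,\,\pi_1\rangle:G\times T(G)_u\to G\times T(G)_u\times T(G)_u\times T(G)_u,$$ where $T(\phi)$ is regarded as a map $T^2(G)\to T(G)\times T(T(G)_u)$.
   Context: Composition is written in diagrammatic order: $fg$ means first $f$, then $g$. Tangent category $(\mathbb X,T,p,0,+,\ell,c)$: a category $\mathbb X$ with a functor $T:\mathbb X\to\mathbb X$ and a natural transformation $p:T\to 1$ such that the pullback powers $T_n(M)$ of $p_M$ ($n$-fold fibre products of $T(M)$ over $M$) exist for all objects $M$ and are preserved by $T$; natural transformations $+:T_2\to T$, $0:1\to T$ making each $p_M$ an additive bundle (a commutative monoid over $M$: $+p=\pi_0p=\pi_1p$, $0p=1$, $+$ associative, commutative, with unit $0$); a natural transformation $\ell:T\to T^2$ such that $(\ell_M,0_M):(p_M,+_M,0_M)\to(T(p_M),T(+_M),T(0_M))$ is an additive bundle morphism (commutes with projections, additions and zeros); a natural transformation $c:T^2\to T^2$ with $c^2=1$, $\ell c=\ell$ such that $(c_M,1):(T(p_M),T(+_M),T(0_M))\to(p_{TM},+_{TM},0_{TM})$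 is an additive bundle morphism; such that $\ell T(\ell)=\ell\,\ell_T$, $T(c)\,c_T\,T(c)=c_T\,T(c)\,c_T$, $\ell_T\,T(c)\,c_T=c\,T(\ell)$, and $\langle\pi_0\ell,\pi_1 0_T\rangle T(+):T_2M\to T^2M$ is the equalizer of $T(p)$ and $T(p)p0:T^2M\to TM$. Cartesian tangent category: a tangent category with all finite products (terminal object $1$) such that the product functor, with the natural isomorphism $T(A)\times T(B)\cong T(A\times B)$, is a strong morphism of tangent categories (the canonical comparison maps are isomorphisms compatible with $p,0,+,\ell,c$). These identifications are suppressed, so e.g. $T(m):T(G)\times T(G)\to T(G)$. $!$ is the unique map to $1$; $f\times g=\langle\pi_0f,\pi_1g\rangle$; $p_u^*:T(G)_u\to T(G)$ is the pullback projection; for $h:X\to T(G)$ with $hp=!u$, $\langle !,h\rangle:X\to T(G)_u$ is the unique map with $\langle !,h\rangle p_u^*=h$. $0_u=\langle !,u0_G\rangle:1\to T(G)_u$; $+_u=\langle !,\langle\pi_0p_u^*,\pi_1p_u^*\rangle+\rangle:T(G)_u\times T(G)_u\to T(G)_u$; $\ell_u:T(G)_u\to T(T(G)_u)$ is the map induced by $\ell$, i.e. the unique map with $\ell_uT(p_u^* )=p_u^*\ell_G$. $\{1\}:T(T(G)_u)\to T(G)_u$ is the unique map with $1=\langle\{1\}\ell_u,\,p0\rangle T(+_u)$ on $T(T(G)_u)$; the map $\langle p,\{1\}\rangle:T(T(G)_u)\to T(G)_u\times T(G)_u$ is an isomorphism with inverse $(0\times\ell_u)T(+_u)$. *)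

theory Defs
  imports Main
begin

text \<open>
  Composition is written in diagrammatic order: \<open>f \<cdot> g\<close> is first \<open>f\<close>, then \<open>g\<close>. It is a total
  function whose value is only constrained on composable pairs. Maps determined by a
  universal property are written with \<open>THE\<close>; they are meaningful only where that
  property holds.
\<close>

section \<open>Categories and limits\<close>

record ('o, 'a) category_data =
  obj :: "'o set"
  arr :: "'a set"
  src :: "'a \<Rightarrow> 'o"
  tgt :: "'a \<Rightarrow> 'o"
  idn :: "'o \<Rightarrow> 'a"  ("\<one>\<index>")
  cmp :: "'a \<Rightarrow> 'a \<Rightarrow> 'a"  (infixl "\<cdot>\<index>" 70)

definition hom :: "('o, 'a, 'm) category_data_scheme \<Rightarrow> 'o \<Rightarrow> 'o \<Rightarrow> 'a set" where
  "hom X A B = {f \<in> arr X. src X f = A \<and> tgt X f = B}"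

locale category =
  fixes X :: "('o, 'a, 'm) category_data_scheme" (structure)
  assumes src_obj: "f \<in> arr X \<Longrightarrow> src X f \<in> obj X"
    and tgt_obj: "f \<in> arr X \<Longrightarrow> tgt X f \<in> obj X"
    and idn_hom: "A \<in> obj X \<Longrightarrow> \<one> A \<in> hom X A A"
    and cmp_hom: "f \<in> hom X A B \<Longrightarrow> g \<in> hom X B D \<Longrightarrow> f \<cdot> g \<in> hom X A D"
    and cmp_idn_left: "f \<in> hom X A B \<Longrightarrow> \<one> A \<cdot> f = f"
    and cmp_idn_right: "f \<in> hom X A B \<Longrightarrow> f \<cdot> \<one> B = f"
    and cmp_assoc: "f \<in> hom X A B \<Longrightarrow> g \<in> hom X B D \<Longrightarrow> h \<in> hom X D E \<Longrightarrow>
      (f \<cdot> g) \<cdot> h = f \<cdot> (g \<cdot> h)"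

definition inverse_arrows :: "('o, 'a, 'm) category_data_scheme \<Rightarrow> 'a \<Rightarrow> 'a \<Rightarrow> bool" where
  "inverse_arrows X f g \<longleftrightarrow>
     f \<in> arr X \<and> g \<in> hom X (tgt X f) (src X f) \<and>
     f \<cdot>\<^bsub>X\<^esub> g = \<one>\<^bsub>X\<^esub> (src X f) \<and> g \<cdot>\<^bsub>X\<^esub> f = \<one>\<^bsub>X\<^esub> (tgt X f)"

definition iso :: "('o, 'a, 'm) category_data_scheme \<Rightarrow> 'a \<Rightarrow> bool" where
  "iso X f \<longleftrightarrow> (\<exists>g. inverse_arrows X f g)"

definition inv_arr :: "('o, 'a, 'm) category_data_scheme \<Rightarrow> 'a \<Rightarrow> 'a" where
  "inv_arr X f = (THE g. inverse_arrows X f g)"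

definition is_terminal :: "('o, 'a, 'm) category_data_scheme \<Rightarrow> 'o \<Rightarrow> bool" where
  "is_terminal X U \<longleftrightarrow> U \<in> obj X \<and> (\<forall>A \<in> obj X. \<exists>!h. h \<in> hom X A U)"

definition is_product ::
  "('o, 'a, 'm) category_data_scheme \<Rightarrow> 'o \<Rightarrow> 'o \<Rightarrow> 'o \<Rightarrow> 'a \<Rightarrow> 'a \<Rightarrow> bool" where
  "is_product X A B P q\<^sub>0 q\<^sub>1 \<longleftrightarrow>
     q\<^sub>0 \<in> hom X P A \<and> q\<^sub>1 \<in> hom X P B \<and>
     (\<forall>Y a b. a \<in> hom X Y A \<longrightarrow> b \<in> hom X Y B \<longrightarrow>
        (\<exists>!h. h \<in> hom X Y P \<and> h \<cdot>\<^bsub>X\<^esub> q\<^sub>0 = a \<and> h \<cdot>\<^bsub>X\<^esub> q\<^sub>1 = b))"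

definition is_pullback ::
  "('o, 'a, 'm) category_data_scheme \<Rightarrow> 'a \<Rightarrow> 'a \<Rightarrow> 'o \<Rightarrow> 'a \<Rightarrow> 'a \<Rightarrow> bool" where
  "is_pullback X f g P q\<^sub>0 q\<^sub>1 \<longleftrightarrow>
     f \<in> arr X \<and> g \<in> arr X \<and> tgt X f = tgt X g \<and>
     q\<^sub>0 \<in> hom X P (src X f) \<and> q\<^sub>1 \<in> hom X P (src X g) \<and> q\<^sub>0 \<cdot>\<^bsub>X\<^esub> f = q\<^sub>1 \<cdot>\<^bsub>X\<^esub> g \<and>
     (\<forall>Y a b. a \<in> hom X Y (src X f) \<longrightarrow> b \<in> hom X Y (src X g) \<longrightarrow> a \<cdot>\<^bsub>X\<^esub> f = b \<cdot>\<^bsub>X\<^esub> g \<longrightarrow>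
        (\<exists>!h. h \<in> hom X Y P \<and> h \<cdot>\<^bsub>X\<^esub> q\<^sub>0 = a \<and> h \<cdot>\<^bsub>X\<^esub> q\<^sub>1 = b))"

text \<open>The \<open>n\<close>-fold fibre product of \<open>f\<close> with itself, i.e. the \<open>n\<close>-th power of \<open>f\<close> in the slice
  over its codomain: \<open>r\<close> is the structure map and \<open>q i\<close>, for \<open>i < n\<close>, are the projections.\<close>

definition is_fibre_power ::
  "('o, 'a, 'm) category_data_scheme \<Rightarrow> nat \<Rightarrow> 'a \<Rightarrow> 'o \<Rightarrow> 'a \<Rightarrow> (nat \<Rightarrow> 'a) \<Rightarrow> bool" where
  "is_fibre_power X n f P r q \<longleftrightarrow>
     f \<in> arr X \<and> r \<in> hom X P (tgt X f) \<and>
     (\<forall>i<n. q i \<in> hom X P (src X f) \<and> q i \<cdot>\<^bsub>X\<^esub> f = r) \<and>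
     (\<forall>Y b a. b \<in> hom X Y (tgt X f) \<longrightarrow>
        (\<forall>i<n. a i \<in> hom X Y (src X f) \<and> a i \<cdot>\<^bsub>X\<^esub> f = b) \<longrightarrow>
        (\<exists>!h. h \<in> hom X Y P \<and> h \<cdot>\<^bsub>X\<^esub> r = b \<and> (\<forall>i<n. h \<cdot>\<^bsub>X\<^esub> q i = a i)))"

definition is_equalizer ::
  "('o, 'a, 'm) category_data_scheme \<Rightarrow> 'a \<Rightarrow> 'a \<Rightarrow> 'o \<Rightarrow> 'a \<Rightarrow> bool" where
  "is_equalizer X f g E e \<longleftrightarrow>
     f \<in> arr X \<and> g \<in> hom X (src X f) (tgt X f) \<and>
     e \<in> hom X E (src X f) \<and> e \<cdot>\<^bsub>X\<^esub> f = e \<cdot>\<^bsub>X\<^esub> g \<and>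
     (\<forall>Y a. a \<in> hom X Y (src X f) \<longrightarrow> a \<cdot>\<^bsub>X\<^esub> f = a \<cdot>\<^bsub>X\<^esub> g \<longrightarrow>
        (\<exists>!h. h \<in> hom X Y E \<and> h \<cdot>\<^bsub>X\<^esub> e = a))"

text \<open>The map into the apex of a product or pullback with legs \<open>q\<^sub>0\<close>, \<open>q\<^sub>1\<close> whose components
  are \<open>a\<close>, \<open>b\<close>.\<close>

definition pairing :: "('o, 'a, 'm) category_data_scheme \<Rightarrow> 'a \<Rightarrow> 'a \<Rightarrow> 'a \<Rightarrow> 'a \<Rightarrow> 'a" where
  "pairing X q\<^sub>0 q\<^sub>1 a b =
     (THE h. h \<in> hom X (src X a) (src X q\<^sub>0) \<and> h \<cdot>\<^bsub>X\<^esub> q\<^sub>0 = a \<and> h \<cdot>\<^bsub>X\<^esub> q\<^sub>1 = b)"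

section \<open>Additive bundles\<close>

text \<open>A bundle carries a choice of the pullback of its projection along itself, given by the two
  projections \<open>bfst\<close>, \<open>bsnd\<close>.\<close>

record 'a add_bundle =
  bproj :: 'a
  bfst :: 'a
  bsnd :: 'a
  badd :: 'a
  bzero :: 'a

abbreviation bpair :: "('o, 'a, 'm) category_data_scheme \<Rightarrow> 'a add_bundle \<Rightarrow> 'a \<Rightarrow> 'a \<Rightarrow> 'a" where
  "bpair X B \<equiv> pairing X (bfst B) (bsnd B)"

text \<open>The monoid laws are stated on generalized elements \<open>a, b, d\<close> of the total space lying over
  the same element of the base.\<close>

definition additive_bundle :: "('o, 'a, 'm) category_data_scheme \<Rightarrow> 'a add_bundle \<Rightarrow> bool" where
  "additive_bundle X B \<longleftrightarrow>
     (let p = bproj B; s = badd B; z = bzero B;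
          E = src X p; M = tgt X p; E2 = src X (bfst B) in
      is_pullback X p p E2 (bfst B) (bsnd B) \<and>
      s \<in> hom X E2 E \<and> z \<in> hom X M E \<and>
      s \<cdot>\<^bsub>X\<^esub> p = bfst B \<cdot>\<^bsub>X\<^esub> p \<and> s \<cdot>\<^bsub>X\<^esub> p = bsnd B \<cdot>\<^bsub>X\<^esub> p \<and> z \<cdot>\<^bsub>X\<^esub> p = \<one>\<^bsub>X\<^esub> M \<and>
      (\<forall>Y a b d. a \<in> hom X Y E \<longrightarrow> b \<in> hom X Y E \<longrightarrow> d \<in> hom X Y E \<longrightarrow>
         a \<cdot>\<^bsub>X\<^esub> p = b \<cdot>\<^bsub>X\<^esub> p \<longrightarrow> b \<cdot>\<^bsub>X\<^esub> p = d \<cdot>\<^bsub>X\<^esub> p \<longrightarrow>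
         bpair X B (bpair X B a b \<cdot>\<^bsub>X\<^esub> s) d \<cdot>\<^bsub>X\<^esub> s = bpair X B a (bpair X B b d \<cdot>\<^bsub>X\<^esub> s) \<cdot>\<^bsub>X\<^esub> s) \<and>
      (\<forall>Y a b. a \<in> hom X Y E \<longrightarrow> b \<in> hom X Y E \<longrightarrow> a \<cdot>\<^bsub>X\<^esub> p = b \<cdot>\<^bsub>X\<^esub> p \<longrightarrow>
         bpair X B a b \<cdot>\<^bsub>X\<^esub> s = bpair X B b a \<cdot>\<^bsub>X\<^esub> s) \<and>
      (\<forall>Y a. a \<in> hom X Y E \<longrightarrow>
         bpair X B (a \<cdot>\<^bsub>X\<^esub> p \<cdot>\<^bsub>X\<^esub> z) a \<cdot>\<^bsub>X\<^esub> s = a \<and> bpair X B a (a \<cdot>\<^bsub>X\<^esub> p \<cdot>\<^bsub>X\<^esub> z) \<cdot>\<^bsub>X\<^esub> s = a))"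

definition additive_bundle_morphism ::
  "('o, 'a, 'm) category_data_scheme \<Rightarrow> 'a add_bundle \<Rightarrow> 'a add_bundle \<Rightarrow> 'a \<Rightarrow> 'a \<Rightarrow> bool" where
  "additive_bundle_morphism X B B' f g \<longleftrightarrow>
     f \<in> hom X (src X (bproj B)) (src X (bproj B')) \<and>
     g \<in> hom X (tgt X (bproj B)) (tgt X (bproj B')) \<and>
     f \<cdot>\<^bsub>X\<^esub> bproj B' = bproj B \<cdot>\<^bsub>X\<^esub> g \<and>
     badd B \<cdot>\<^bsub>X\<^esub> f = bpair X B' (bfst B \<cdot>\<^bsub>X\<^esub> f) (bsnd B \<cdot>\<^bsub>X\<^esub> f) \<cdot>\<^bsub>X\<^esub> badd B' \<and>
     bzero B \<cdot>\<^bsub>X\<^esub> f = g \<cdot>\<^bsub>X\<^esub> bzero B'"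

section \<open>Tangent categories\<close>

text \<open>\<open>\<T>\<^sub>o\<close> and \<open>\<T>\<close> are the object and arrow parts of the tangent functor; \<open>T2 M\<close> with
  projections \<open>\<rho>\<^sub>0 M\<close>, \<open>\<rho>\<^sub>1 M\<close> is a chosen pullback of \<open>\<p> M\<close> along itself; \<open>\<ss>\<close> is the addition.\<close>

record ('o, 'a) tangent_data = "('o, 'a) category_data" +
  tan_obj :: "'o \<Rightarrow> 'o"  ("\<T>\<^sub>o\<index>")
  tan_arr :: "'a \<Rightarrow> 'a"  ("\<T>\<index>")
  tproj :: "'o \<Rightarrow> 'a"  ("\<p>\<index>")
  T2 :: "'o \<Rightarrow> 'o"
  T2_fst :: "'o \<Rightarrow> 'a"  ("\<rho>\<^sub>0\<index>")
  T2_snd :: "'o \<Rightarrow> 'a"  ("\<rho>\<^sub>1\<index>")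
  tadd :: "'o \<Rightarrow> 'a"  ("\<ss>\<index>")
  tzero :: "'o \<Rightarrow> 'a"  ("\<zero>\<index>")
  tlift :: "'o \<Rightarrow> 'a"  ("\<ell>\<index>")
  tflip :: "'o \<Rightarrow> 'a"  ("\<c>\<index>")

definition T2_arr :: "('o, 'a, 'm) tangent_data_scheme \<Rightarrow> 'a \<Rightarrow> 'a" where
  "T2_arr X f = (let M = src X f; N = tgt X f in
     pairing X (\<rho>\<^sub>0\<^bsub>X\<^esub> N) (\<rho>\<^sub>1\<^bsub>X\<^esub> N) (\<rho>\<^sub>0\<^bsub>X\<^esub> M \<cdot>\<^bsub>X\<^esub> \<T>\<^bsub>X\<^esub> f) (\<rho>\<^sub>1\<^bsub>X\<^esub> M \<cdot>\<^bsub>X\<^esub> \<T>\<^bsub>X\<^esub> f))"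

definition tangent_bundle :: "('o, 'a, 'm) tangent_data_scheme \<Rightarrow> 'o \<Rightarrow> 'a add_bundle" where
  "tangent_bundle X M = \<lparr>bproj = \<p>\<^bsub>X\<^esub> M, bfst = \<rho>\<^sub>0\<^bsub>X\<^esub> M, bsnd = \<rho>\<^sub>1\<^bsub>X\<^esub> M,
     badd = \<ss>\<^bsub>X\<^esub> M, bzero = \<zero>\<^bsub>X\<^esub> M\<rparr>"

definition tan_bundle_image :: "('o, 'a, 'm) tangent_data_scheme \<Rightarrow> 'a add_bundle \<Rightarrow> 'a add_bundle" where
  "tan_bundle_image X B = \<lparr>bproj = \<T>\<^bsub>X\<^esub> (bproj B), bfst = \<T>\<^bsub>X\<^esub> (bfst B), bsnd = \<T>\<^bsub>X\<^esub> (bsnd B),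
     badd = \<T>\<^bsub>X\<^esub> (badd B), bzero = \<T>\<^bsub>X\<^esub> (bzero B)\<rparr>"

locale tangent_category = category X
  for X :: "('o, 'a, 'm) tangent_data_scheme" (structure) +
  assumes tan_obj: "M \<in> obj X \<Longrightarrow> \<T>\<^sub>o M \<in> obj X"
    and tan_hom: "f \<in> hom X M N \<Longrightarrow> \<T> f \<in> hom X (\<T>\<^sub>o M) (\<T>\<^sub>o N)"
    and tan_idn: "M \<in> obj X \<Longrightarrow> \<T> (\<one> M) = \<one> (\<T>\<^sub>o M)"
    and tan_cmp: "f \<in> hom X M N \<Longrightarrow> g \<in> hom X N Q \<Longrightarrow> \<T> (f \<cdot> g) = \<T> f \<cdot> \<T> g"
    \<comment> \<open>types of the structure maps\<close>
    and proj_hom: "M \<in> obj X \<Longrightarrow> \<p> M \<in> hom X (\<T>\<^sub>o M) M"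
    and T2_pullback: "M \<in> obj X \<Longrightarrow> is_pullback X (\<p> M) (\<p> M) (T2 X M) (\<rho>\<^sub>0 M) (\<rho>\<^sub>1 M)"
    and add_hom: "M \<in> obj X \<Longrightarrow> \<ss> M \<in> hom X (T2 X M) (\<T>\<^sub>o M)"
    and zero_hom: "M \<in> obj X \<Longrightarrow> \<zero> M \<in> hom X M (\<T>\<^sub>o M)"
    and lift_hom: "M \<in> obj X \<Longrightarrow> \<ell> M \<in> hom X (\<T>\<^sub>o M) (\<T>\<^sub>o (\<T>\<^sub>o M))"
    and flip_hom: "M \<in> obj X \<Longrightarrow> \<c> M \<in> hom X (\<T>\<^sub>o (\<T>\<^sub>o M)) (\<T>\<^sub>o (\<T>\<^sub>o M))"
    \<comment> \<open>naturality\<close>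
    and proj_nat: "f \<in> hom X M N \<Longrightarrow> \<T> f \<cdot> \<p> N = \<p> M \<cdot> f"
    and add_nat: "f \<in> hom X M N \<Longrightarrow> T2_arr X f \<cdot> \<ss> N = \<ss> M \<cdot> \<T> f"
    and zero_nat: "f \<in> hom X M N \<Longrightarrow> f \<cdot> \<zero> N = \<zero> M \<cdot> \<T> f"
    and lift_nat: "f \<in> hom X M N \<Longrightarrow> \<T> f \<cdot> \<ell> N = \<ell> M \<cdot> \<T> (\<T> f)"
    and flip_nat: "f \<in> hom X M N \<Longrightarrow> \<T> (\<T> f) \<cdot> \<c> N = \<c> M \<cdot> \<T> (\<T> f)"
    \<comment> \<open>pullback powers of the projection\<close>
    and fibre_power_exists: "M \<in> obj X \<Longrightarrow> \<exists>P r q. is_fibre_power X n (\<p> M) P r q"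
    and fibre_power_preserved: "M \<in> obj X \<Longrightarrow> is_fibre_power X n (\<p> M) P r q \<Longrightarrow>
      is_fibre_power X n (\<T> (\<p> M)) (\<T>\<^sub>o P) (\<T> r) (\<lambda>i. \<T> (q i))"
    \<comment> \<open>additive bundle structure\<close>
    and tangent_additive: "M \<in> obj X \<Longrightarrow> additive_bundle X (tangent_bundle X M)"
    and lift_additive: "M \<in> obj X \<Longrightarrow> additive_bundle_morphism X
      (tangent_bundle X M) (tan_bundle_image X (tangent_bundle X M)) (\<ell> M) (\<zero> M)"
    and flip_additive: "M \<in> obj X \<Longrightarrow> additive_bundle_morphism X
      (tan_bundle_image X (tangent_bundle X M)) (tangent_bundle X (\<T>\<^sub>o M)) (\<c> M) (\<one> (\<T>\<^sub>o M))"
    \<comment> \<open>coherence\<close>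
    and flip_flip: "M \<in> obj X \<Longrightarrow> \<c> M \<cdot> \<c> M = \<one> (\<T>\<^sub>o (\<T>\<^sub>o M))"
    and lift_flip: "M \<in> obj X \<Longrightarrow> \<ell> M \<cdot> \<c> M = \<ell> M"
    and lift_lift: "M \<in> obj X \<Longrightarrow> \<ell> M \<cdot> \<T> (\<ell> M) = \<ell> M \<cdot> \<ell> (\<T>\<^sub>o M)"
    and flip_braid: "M \<in> obj X \<Longrightarrow>
      \<T> (\<c> M) \<cdot> \<c> (\<T>\<^sub>o M) \<cdot> \<T> (\<c> M) = \<c> (\<T>\<^sub>o M) \<cdot> \<T> (\<c> M) \<cdot> \<c> (\<T>\<^sub>o M)"
    and lift_flip_flip: "M \<in> obj X \<Longrightarrow>
      \<ell> (\<T>\<^sub>o M) \<cdot> \<T> (\<c> M) \<cdot> \<c> (\<T>\<^sub>o M) = \<c> M \<cdot> \<T> (\<ell> M)"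
    \<comment> \<open>universality of the vertical lift; the pairing below is a map \<open>T2 M \<rightarrow> \<T>\<^sub>o (T2 M)\<close>\<close>
    and lift_universal: "M \<in> obj X \<Longrightarrow>
      is_equalizer X (\<T> (\<p> M)) (\<T> (\<p> M) \<cdot> \<p> M \<cdot> \<zero> M) (T2 X M)
        (pairing X (\<T> (\<rho>\<^sub>0 M)) (\<T> (\<rho>\<^sub>1 M)) (\<rho>\<^sub>0 M \<cdot> \<ell> M) (\<rho>\<^sub>1 M \<cdot> \<zero> (\<T>\<^sub>o M)) \<cdot> \<T> (\<ss> M))"

section \<open>Cartesian tangent categories\<close>

record ('o, 'a) cartesian_tangent_data = "('o, 'a) tangent_data" +
  prd :: "'o \<Rightarrow> 'o \<Rightarrow> 'o"  (infixr "\<times>\<^sub>o\<index>" 80)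
  prd_fst :: "'o \<Rightarrow> 'o \<Rightarrow> 'a"  ("\<pi>\<^sub>0\<index>")
  prd_snd :: "'o \<Rightarrow> 'o \<Rightarrow> 'a"  ("\<pi>\<^sub>1\<index>")
  unit_obj :: 'o  ("\<I>\<index>")

definition bang :: "('o, 'a, 'm) cartesian_tangent_data_scheme \<Rightarrow> 'o \<Rightarrow> 'a" ("\<tau>\<index>") where
  "\<tau>\<^bsub>X\<^esub> A = (THE h. h \<in> hom X A \<I>\<^bsub>X\<^esub>)"

definition pair :: "('o, 'a, 'm) cartesian_tangent_data_scheme \<Rightarrow> 'a \<Rightarrow> 'a \<Rightarrow> 'a"
  ("(\<langle>_,/ _\<rangle>\<index>)") where
  "\<langle>f, g\<rangle>\<^bsub>X\<^esub> = pairing X (\<pi>\<^sub>0\<^bsub>X\<^esub> (tgt X f) (tgt X g)) (\<pi>\<^sub>1\<^bsub>X\<^esub> (tgt X f) (tgt X g)) f g"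

definition prd_arr :: "('o, 'a, 'm) cartesian_tangent_data_scheme \<Rightarrow> 'a \<Rightarrow> 'a \<Rightarrow> 'a"
  (infixr "\<times>\<^sub>a\<index>" 80) where
  "f \<times>\<^sub>a\<^bsub>X\<^esub> g = \<langle>\<pi>\<^sub>0\<^bsub>X\<^esub> (src X f) (src X g) \<cdot>\<^bsub>X\<^esub> f, \<pi>\<^sub>1\<^bsub>X\<^esub> (src X f) (src X g) \<cdot>\<^bsub>X\<^esub> g\<rangle>\<^bsub>X\<^esub>"

text \<open>The canonical comparison maps \<open>T(A \<times> B) \<rightarrow> T(A) \<times> T(B)\<close> and
  \<open>T\<^sub>2(A \<times> B) \<rightarrow> T\<^sub>2(A) \<times> T\<^sub>2(B)\<close>.\<close>

definition tan_split :: "('o, 'a, 'm) cartesian_tangent_data_scheme \<Rightarrow> 'o \<Rightarrow> 'o \<Rightarrow> 'a"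
  ("\<sigma>\<index>") where
  "\<sigma>\<^bsub>X\<^esub> A B = \<langle>\<T>\<^bsub>X\<^esub> (\<pi>\<^sub>0\<^bsub>X\<^esub> A B), \<T>\<^bsub>X\<^esub> (\<pi>\<^sub>1\<^bsub>X\<^esub> A B)\<rangle>\<^bsub>X\<^esub>"

definition T2_split :: "('o, 'a, 'm) cartesian_tangent_data_scheme \<Rightarrow> 'o \<Rightarrow> 'o \<Rightarrow> 'a" where
  "T2_split X A B = \<langle>T2_arr X (\<pi>\<^sub>0\<^bsub>X\<^esub> A B), T2_arr X (\<pi>\<^sub>1\<^bsub>X\<^esub> A B)\<rangle>\<^bsub>X\<^esub>"

text \<open>For the terminal object only invertibility of the comparison map has to be required:
  its compatibility conditions are equations between maps into \<open>\<I>\<close>.\<close>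

locale cartesian_tangent_category = tangent_category X
  for X :: "('o, 'a, 'm) cartesian_tangent_data_scheme" (structure) +
  assumes unit_terminal: "is_terminal X \<I>"
    and prd_product: "A \<in> obj X \<Longrightarrow> B \<in> obj X \<Longrightarrow>
      is_product X A B (A \<times>\<^sub>o B) (\<pi>\<^sub>0 A B) (\<pi>\<^sub>1 A B)"
    and tan_unit_iso: "iso X (\<tau> (\<T>\<^sub>o \<I>))"
    and split_iso: "A \<in> obj X \<Longrightarrow> B \<in> obj X \<Longrightarrow> iso X (\<sigma> A B)"
    and split_proj: "A \<in> obj X \<Longrightarrow> B \<in> obj X \<Longrightarrow>
      \<sigma> A B \<cdot> (\<p> A \<times>\<^sub>a \<p> B) = \<p> (A \<times>\<^sub>o B)"
    and split_zero: "A \<in> obj X \<Longrightarrow> B \<in> obj X \<Longrightarrow>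
      \<zero> (A \<times>\<^sub>o B) \<cdot> \<sigma> A B = \<zero> A \<times>\<^sub>a \<zero> B"
    and split_add: "A \<in> obj X \<Longrightarrow> B \<in> obj X \<Longrightarrow>
      \<ss> (A \<times>\<^sub>o B) \<cdot> \<sigma> A B = T2_split X A B \<cdot> (\<ss> A \<times>\<^sub>a \<ss> B)"
    and split_lift: "A \<in> obj X \<Longrightarrow> B \<in> obj X \<Longrightarrow>
      \<ell> (A \<times>\<^sub>o B) \<cdot> \<T> (\<sigma> A B) \<cdot> \<sigma> (\<T>\<^sub>o A) (\<T>\<^sub>o B) = \<sigma> A B \<cdot> (\<ell> A \<times>\<^sub>a \<ell> B)"
    and split_flip: "A \<in> obj X \<Longrightarrow> B \<in> obj X \<Longrightarrow>
      \<c> (A \<times>\<^sub>o B) \<cdot> \<T> (\<sigma> A B) \<cdot> \<sigma> (\<T>\<^sub>o A) (\<T>\<^sub>o B)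
        = \<T> (\<sigma> A B) \<cdot> \<sigma> (\<T>\<^sub>o A) (\<T>\<^sub>o B) \<cdot> (\<c> A \<times>\<^sub>a \<c> B)"

text \<open>The identification \<open>T(A) \<times> T(B) \<cong> T(A \<times> B)\<close> made explicit: \<open>tan_from_prd X A B f\<close> is \<open>T(f)\<close>
  for \<open>f : A \<times> B \<rightarrow> C\<close>, read as a map \<open>T(A) \<times> T(B) \<rightarrow> T(C)\<close>, and \<open>tan_to_prd X A B f\<close> is \<open>T(f)\<close>
  for \<open>f : C \<rightarrow> A \<times> B\<close>, read as a map \<open>T(C) \<rightarrow> T(A) \<times> T(B)\<close>.\<close>

definition tan_from_prd ::
  "('o, 'a, 'm) cartesian_tangent_data_scheme \<Rightarrow> 'o \<Rightarrow> 'o \<Rightarrow> 'a \<Rightarrow> 'a" where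
  "tan_from_prd X A B f = inv_arr X (\<sigma>\<^bsub>X\<^esub> A B) \<cdot>\<^bsub>X\<^esub> \<T>\<^bsub>X\<^esub> f"

definition tan_to_prd ::
  "('o, 'a, 'm) cartesian_tangent_data_scheme \<Rightarrow> 'o \<Rightarrow> 'o \<Rightarrow> 'a \<Rightarrow> 'a" where
  "tan_to_prd X A B f = \<T>\<^bsub>X\<^esub> f \<cdot>\<^bsub>X\<^esub> \<sigma>\<^bsub>X\<^esub> A B"

section \<open>Group objects and the tangent space at the unit\<close>

locale group_object = cartesian_tangent_category X
  for X :: "('o, 'a, 'm) cartesian_tangent_data_scheme" (structure) +
  fixes G :: 'o and m u \<iota> :: 'a
  assumes G_obj: "G \<in> obj X"
    and mult_hom: "m \<in> hom X (G \<times>\<^sub>o G) G"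
    and unit_hom: "u \<in> hom X \<I> G"
    and inv_hom: "\<iota> \<in> hom X G G"
    and mult_assoc: "(m \<times>\<^sub>a \<one> G) \<cdot> m =
      \<langle>\<pi>\<^sub>0 (G \<times>\<^sub>o G) G \<cdot> \<pi>\<^sub>0 G G, \<langle>\<pi>\<^sub>0 (G \<times>\<^sub>o G) G \<cdot> \<pi>\<^sub>1 G G, \<pi>\<^sub>1 (G \<times>\<^sub>o G) G\<rangle>\<rangle> \<cdot> (\<one> G \<times>\<^sub>a m) \<cdot> m"
    and mult_unit_left: "\<langle>\<tau> G \<cdot> u, \<one> G\<rangle> \<cdot> m = \<one> G"
    and mult_unit_right: "\<langle>\<one> G, \<tau> G \<cdot> u\<rangle> \<cdot> m = \<one> G"
    and mult_inv_left: "\<langle>\<iota>, \<one> G\<rangle> \<cdot> m = \<tau> G \<cdot> u"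
    and mult_inv_right: "\<langle>\<one> G, \<iota>\<rangle> \<cdot> m = \<tau> G \<cdot> u"

text \<open>Below, \<open>k : K \<rightarrow> T(G)\<close> stands for the pullback projection \<open>p\<^sub>u\<^sup>* : T(G)\<^sub>u \<rightarrow> T(G)\<close>, so that
  \<open>K = T(G)\<^sub>u = src X k\<close>, and \<open>tan_space_lift X k h\<close> is \<open>\<langle>!, h\<rangle> : Y \<rightarrow> T(G)\<^sub>u\<close>.\<close>

definition tan_space_lift ::
  "('o, 'a, 'm) cartesian_tangent_data_scheme \<Rightarrow> 'a \<Rightarrow> 'a \<Rightarrow> 'a" where
  "tan_space_lift X k h = (THE g. g \<in> hom X (src X h) (src X k) \<and> g \<cdot>\<^bsub>X\<^esub> k = h)"

definition tan_space_zero ::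
  "('o, 'a, 'm) cartesian_tangent_data_scheme \<Rightarrow> 'o \<Rightarrow> 'a \<Rightarrow> 'a \<Rightarrow> 'a" where
  "tan_space_zero X G u k = tan_space_lift X k (u \<cdot>\<^bsub>X\<^esub> \<zero>\<^bsub>X\<^esub> G)"

definition tan_space_add ::
  "('o, 'a, 'm) cartesian_tangent_data_scheme \<Rightarrow> 'o \<Rightarrow> 'a \<Rightarrow> 'a" where
  "tan_space_add X G k = (let K = src X k in
     tan_space_lift X k
       (pairing X (\<rho>\<^sub>0\<^bsub>X\<^esub> G) (\<rho>\<^sub>1\<^bsub>X\<^esub> G) (\<pi>\<^sub>0\<^bsub>X\<^esub> K K \<cdot>\<^bsub>X\<^esub> k) (\<pi>\<^sub>1\<^bsub>X\<^esub> K K \<cdot>\<^bsub>X\<^esub> k) \<cdot>\<^bsub>X\<^esub> \<ss>\<^bsub>X\<^esub> G))"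

definition tan_space_vlift ::
  "('o, 'a, 'm) cartesian_tangent_data_scheme \<Rightarrow> 'o \<Rightarrow> 'a \<Rightarrow> 'a" where
  "tan_space_vlift X G k = (let K = src X k in
     THE f. f \<in> hom X K (\<T>\<^sub>o\<^bsub>X\<^esub> K) \<and> f \<cdot>\<^bsub>X\<^esub> \<T>\<^bsub>X\<^esub> k = k \<cdot>\<^bsub>X\<^esub> \<ell>\<^bsub>X\<^esub> G)"

text \<open>The map \<open>{1} : T(T(G)\<^sub>u) \<rightarrow> T(G)\<^sub>u\<close> extracting the vertical component.\<close>

definition tan_space_vert ::
  "('o, 'a, 'm) cartesian_tangent_data_scheme \<Rightarrow> 'o \<Rightarrow> 'a \<Rightarrow> 'a" where
  "tan_space_vert X G k = (let K = src X k in
     THE f. f \<in> hom X (\<T>\<^sub>o\<^bsub>X\<^esub> K) K \<and>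
       \<one>\<^bsub>X\<^esub> (\<T>\<^sub>o\<^bsub>X\<^esub> K) =
         \<langle>f \<cdot>\<^bsub>X\<^esub> tan_space_vlift X G k, \<p>\<^bsub>X\<^esub> K \<cdot>\<^bsub>X\<^esub> \<zero>\<^bsub>X\<^esub> K\<rangle>\<^bsub>X\<^esub> \<cdot>\<^bsub>X\<^esub> tan_from_prd X K K (tan_space_add X G k))"

definition trivialization ::
  "('o, 'a, 'm) cartesian_tangent_data_scheme \<Rightarrow> 'o \<Rightarrow> 'a \<Rightarrow> 'a \<Rightarrow> 'a \<Rightarrow> 'a" where
  "trivialization X G m \<iota> k =
     \<langle>\<p>\<^bsub>X\<^esub> G,
      tan_space_lift X k
        (\<langle>\<p>\<^bsub>X\<^esub> G \<cdot>\<^bsub>X\<^esub> \<iota> \<cdot>\<^bsub>X\<^esub> \<zero>\<^bsub>X\<^esub> G, \<one>\<^bsub>X\<^esub> (\<T>\<^sub>o\<^bsub>X\<^esub> G)\<rangle>\<^bsub>X\<^esub> \<cdot>\<^bsub>X\<^esub> tan_from_prd X G G m)\<rangle>\<^bsub>X\<^esub>"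

end

theory Submission
  imports Defs
begin

text \<open>
  Write the group law on generalized elements \<open>Y \<rightarrow> G\<close> multiplicatively. Applying \<open>T\<close> turns \<open>T(G)\<close>
  into a group object with multiplication \<open>T(m)\<close> (\<open>tangent_group\<close>), and doing so again gives a
  group structure on \<open>T\<^sup>2(G)\<close>. By naturality the projection, the zero section and the lift \<open>\<ell>\<close> are
  homomorphisms between these groups. Hence \<open>a \<mapsto> 0(ap)\<^sup>-\<^sup>1 a\<close> moves a tangent vector to the unit,
  and \<open>(g, v) \<mapsto> 0(g)v\<close> is inverse to \<open>\<phi>\<close>.

  For the lift, \<open>\<ell>(0(g)v) = \<ell>(0(g)) \<ell>(v) = 00(g) \<ell>(v)\<close>. Its first component under \<open>T(\<phi>)\<close> is its
  image under \<open>T(p)\<close>, the zero vector \<open>0(g)\<close>, whose trivialization is \<open>(g, 0)\<close>. Its second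
  component is \<open>00(g)\<^sup>-\<^sup>1 00(g) \<ell>(v)\<close>, the lift of \<open>v\<close> (\<open>psi_lift_shear\<close>). It remains to see that
  \<open>\<langle>p, {1}\<rangle>\<close> sends \<open>\<ell>\<^sub>u(v)\<close> to \<open>(0, v)\<close>: the base point is zero since \<open>\<ell>p = p0\<close>, and \<open>\<ell>\<^sub>u{1} = 1\<close>
  because \<open>\<ell>\<^sub>u = \<ell>\<^sub>u + 0\<close> already is a splitting of the kind that defines \<open>{1}\<close> (\<open>vlift_vert\<close>).

  That such splittings exist and are unique (\<open>splits_exists\<close>, \<open>splits_unique\<close>) is the universality
  of the lift on \<open>G\<close>, restricted along \<open>T(p\<^sub>u\<^sup>*)\<close>: a map into \<open>T(T(G)\<^sub>u)\<close> becomes, in \<open>T\<^sup>2(G)\<close>, an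
  element of the equalizer of \<open>T(p)\<close> and \<open>T(p)p0\<close>, and \<open>T(p\<^sub>u\<^sup>*)\<close> is monic since \<open>T(1)\<close> is terminal.
\<close>

section \<open>Typing and universal arrows in a category\<close>

text \<open>Reducing membership in a hom set to equations for sources and targets lets conditional
  rewriting discharge the typing of composites and reassociate them to the right.\<close>

lemma hom_iff [simp]: "f \<in> hom X A B \<longleftrightarrow> f \<in> arr X \<and> src X f = A \<and> tgt X f = B"
  by (simp add: hom_def)

lemma homD:
  assumes "f \<in> hom X A B"
  shows "f \<in> arr X" "src X f = A" "tgt X f = B"
  using assms by auto

lemma homI: "f \<in> arr X \<Longrightarrow> src X f = A \<Longrightarrow> tgt X f = B \<Longrightarrow> f \<in> hom X A B"
  by simp

context category
begin

lemma arr_cmp [simp]: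
  assumes "f \<in> arr X" "g \<in> arr X" "tgt X f = src X g"
  shows "f \<cdot> g \<in> arr X" "src X (f \<cdot> g) = src X f" "tgt X (f \<cdot> g) = tgt X g"
  using cmp_hom[of f "src X f" "tgt X f" g "tgt X g"] assms by auto

lemma arr_idn [simp]:
  assumes "A \<in> obj X"
  shows "\<one> A \<in> arr X" "src X (\<one> A) = A" "tgt X (\<one> A) = A"
  using idn_hom[OF assms] by auto

lemma idn_cmp [simp]: "f \<in> arr X \<Longrightarrow> src X f = A \<Longrightarrow> \<one> A \<cdot> f = f"
  by (rule cmp_idn_left[of f A "tgt X f"]) auto

lemma cmp_idn [simp]: "f \<in> arr X \<Longrightarrow> tgt X f = A \<Longrightarrow> f \<cdot> \<one> A = f"
  by (rule cmp_idn_right[of f "src X f"]) auto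

lemma cmp_assoc_arr [simp]:
  "f \<in> arr X \<Longrightarrow> g \<in> arr X \<Longrightarrow> h \<in> arr X \<Longrightarrow> tgt X f = src X g \<Longrightarrow> tgt X g = src X h \<Longrightarrow>
    (f \<cdot> g) \<cdot> h = f \<cdot> (g \<cdot> h)"
  by (rule cmp_assoc[of f "src X f" "tgt X f" g "tgt X g" h "tgt X h"]) auto

declare src_obj [simp] tgt_obj [simp]

lemma cmp_eq_extend:
  assumes "f \<cdot> g = f' \<cdot> g'" "f \<in> arr X" "g \<in> arr X" "f' \<in> arr X" "g' \<in> arr X" "h \<in> arr X"
    "tgt X f = src X g" "tgt X f' = src X g'" "tgt X g = src X h" "tgt X g' = src X h"
  shows "f \<cdot> (g \<cdot> h) = f' \<cdot> (g' \<cdot> h)"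
  using assms cmp_assoc_arr by metis

lemma inverse_arrows_unique:
  assumes "inverse_arrows X f g" "inverse_arrows X f g'"
  shows "g = g'"
proof -
  have f: "f \<in> arr X" and g: "g \<in> hom X (tgt X f) (src X f)" "g \<cdot> f = \<one> (tgt X f)"
    and g': "g' \<in> hom X (tgt X f) (src X f)" "f \<cdot> g' = \<one> (src X f)"
    using assms by (simp_all add: inverse_arrows_def)
  have "g = g \<cdot> (f \<cdot> g')"
    unfolding g'(2) using f g(1) by simp
  also have "\<dots> = (g \<cdot> f) \<cdot> g'"
    using f g(1) g'(1) by simp
  also have "\<dots> = g'"
    unfolding g(2) using f g'(1) by simp
  finally show ?thesis .
qed

lemma inv_arr_eq: "inverse_arrows X f g \<Longrightarrow> inv_arr X f = g"
  unfolding inv_arr_def by (blast intro: inverse_arrows_unique)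

lemma iso_inverse: "iso X f \<Longrightarrow> inverse_arrows X f (inv_arr X f)"
  unfolding iso_def using inv_arr_eq by blast

lemma pairing_pullback:
  assumes "is_pullback X f g P q\<^sub>0 q\<^sub>1" "a \<in> hom X Y (src X f)" "b \<in> hom X Y (src X g)"
    "a \<cdot> f = b \<cdot> g"
  shows "pairing X q\<^sub>0 q\<^sub>1 a b \<in> hom X Y P" "pairing X q\<^sub>0 q\<^sub>1 a b \<cdot> q\<^sub>0 = a"
    "pairing X q\<^sub>0 q\<^sub>1 a b \<cdot> q\<^sub>1 = b"
proof -
  have "\<exists>!h. h \<in> hom X Y P \<and> h \<cdot> q\<^sub>0 = a \<and> h \<cdot> q\<^sub>1 = b"
    using assms(1)[unfolded is_pullback_def] assms(2-4) by blast
  moreover have "src X a = Y" "src X q\<^sub>0 = P"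
    using assms unfolding is_pullback_def by auto
  ultimately have "pairing X q\<^sub>0 q\<^sub>1 a b \<in> hom X Y P \<and> pairing X q\<^sub>0 q\<^sub>1 a b \<cdot> q\<^sub>0 = a \<and>
      pairing X q\<^sub>0 q\<^sub>1 a b \<cdot> q\<^sub>1 = b"
    using theI'[of "\<lambda>h. h \<in> hom X Y P \<and> h \<cdot> q\<^sub>0 = a \<and> h \<cdot> q\<^sub>1 = b"]
    unfolding pairing_def by blast
  then show "pairing X q\<^sub>0 q\<^sub>1 a b \<in> hom X Y P" "pairing X q\<^sub>0 q\<^sub>1 a b \<cdot> q\<^sub>0 = a"
    "pairing X q\<^sub>0 q\<^sub>1 a b \<cdot> q\<^sub>1 = b" by auto
qed

lemma pullback_ext:
  assumes "is_pullback X f g P q\<^sub>0 q\<^sub>1" "h \<in> hom X Y P" "h' \<in> hom X Y P"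
    "h \<cdot> q\<^sub>0 = h' \<cdot> q\<^sub>0" "h \<cdot> q\<^sub>1 = h' \<cdot> q\<^sub>1"
  shows "h = h'"
proof -
  have q: "f \<in> arr X" "g \<in> arr X" "q\<^sub>0 \<in> hom X P (src X f)" "q\<^sub>1 \<in> hom X P (src X g)"
    "q\<^sub>0 \<cdot> f = q\<^sub>1 \<cdot> g"
    using assms(1) by (auto simp: is_pullback_def)
  have "h \<cdot> q\<^sub>0 \<cdot> f = h \<cdot> q\<^sub>1 \<cdot> g"
    using q assms(2) by simp
  moreover have "h \<cdot> q\<^sub>0 \<in> hom X Y (src X f)" "h \<cdot> q\<^sub>1 \<in> hom X Y (src X g)"
    using q assms(2) by (auto intro: cmp_hom)
  ultimately show ?thesis
    using assms unfolding is_pullback_def by metis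
qed

end

section \<open>The tangent functor and the pullback of the projection along itself\<close>

context tangent_category
begin

lemma arr_tan [simp]:
  assumes "f \<in> arr X"
  shows "\<T> f \<in> arr X" "src X (\<T> f) = \<T>\<^sub>o (src X f)" "tgt X (\<T> f) = \<T>\<^sub>o (tgt X f)"
  using tan_hom[of f "src X f" "tgt X f"] assms by auto

lemma tan_cmp_arr [simp]:
  "f \<in> arr X \<Longrightarrow> g \<in> arr X \<Longrightarrow> tgt X f = src X g \<Longrightarrow> \<T> (f \<cdot> g) = \<T> f \<cdot> \<T> g"
  by (rule tan_cmp[of f "src X f" "tgt X f" g "tgt X g"]) auto

declare tan_obj [simp] tan_idn [simp]

lemma arr_structure [simp]:
  assumes "M \<in> obj X"
  shows "\<p> M \<in> arr X" "src X (\<p> M) = \<T>\<^sub>o M" "tgt X (\<p> M) = M"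
    "\<zero> M \<in> arr X" "src X (\<zero> M) = M" "tgt X (\<zero> M) = \<T>\<^sub>o M"
    "\<ell> M \<in> arr X" "src X (\<ell> M) = \<T>\<^sub>o M" "tgt X (\<ell> M) = \<T>\<^sub>o (\<T>\<^sub>o M)"
    "\<c> M \<in> arr X" "src X (\<c> M) = \<T>\<^sub>o (\<T>\<^sub>o M)" "tgt X (\<c> M) = \<T>\<^sub>o (\<T>\<^sub>o M)"
    "\<ss> M \<in> arr X" "src X (\<ss> M) = T2 X M" "tgt X (\<ss> M) = \<T>\<^sub>o M"
    "\<rho>\<^sub>0 M \<in> arr X" "src X (\<rho>\<^sub>0 M) = T2 X M" "tgt X (\<rho>\<^sub>0 M) = \<T>\<^sub>o M"
    "\<rho>\<^sub>1 M \<in> arr X" "src X (\<rho>\<^sub>1 M) = T2 X M" "tgt X (\<rho>\<^sub>1 M) = \<T>\<^sub>o M"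
  using proj_hom[OF assms] zero_hom[OF assms] lift_hom[OF assms] flip_hom[OF assms]
    add_hom[OF assms] T2_pullback[OF assms]
  by (auto simp: is_pullback_def)

lemma proj_nat_arr: "f \<in> arr X \<Longrightarrow> tgt X f = N \<Longrightarrow> \<T> f \<cdot> \<p> N = \<p> (src X f) \<cdot> f"
  by (rule proj_nat) auto

lemma zero_nat_arr: "f \<in> arr X \<Longrightarrow> tgt X f = N \<Longrightarrow> f \<cdot> \<zero> N = \<zero> (src X f) \<cdot> \<T> f"
  by (rule zero_nat) auto

lemma lift_nat_arr: "f \<in> arr X \<Longrightarrow> tgt X f = N \<Longrightarrow> \<T> f \<cdot> \<ell> N = \<ell> (src X f) \<cdot> \<T> (\<T> f)"
  by (rule lift_nat) auto

lemma zero_nat_ext: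
  "f \<in> arr X \<Longrightarrow> tgt X f = N \<Longrightarrow> N \<in> obj X \<Longrightarrow> h \<in> arr X \<Longrightarrow> src X h = \<T>\<^sub>o N \<Longrightarrow>
    f \<cdot> (\<zero> N \<cdot> h) = \<zero> (src X f) \<cdot> (\<T> f \<cdot> h)"
  by (rule cmp_eq_extend) (auto simp: zero_nat_arr)

lemma zero_proj [simp]: "M \<in> obj X \<Longrightarrow> \<zero> M \<cdot> \<p> M = \<one> M"
  using tangent_additive[of M]
  by (simp add: additive_bundle_def tangent_bundle_def Let_def)

lemma zero_proj_ext [simp]:
  assumes "M \<in> obj X" "h \<in> arr X" "src X h = M"
  shows "\<zero> M \<cdot> (\<p> M \<cdot> h) = h"
proof -
  have "(\<zero> M \<cdot> \<p> M) \<cdot> h = h"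
    by (simp del: cmp_assoc_arr add: assms)
  then show ?thesis by (simp del: zero_proj add: assms)
qed

lemma lift_tan_proj: "M \<in> obj X \<Longrightarrow> \<ell> M \<cdot> \<T> (\<p> M) = \<p> M \<cdot> \<zero> M"
  using lift_additive[of M]
  by (simp add: additive_bundle_morphism_def tangent_bundle_def tan_bundle_image_def)

lemma zero_lift: "M \<in> obj X \<Longrightarrow> \<zero> M \<cdot> \<ell> M = \<zero> M \<cdot> \<T> (\<zero> M)"
  using lift_additive[of M]
  by (simp add: additive_bundle_morphism_def tangent_bundle_def tan_bundle_image_def)

lemma add_lift: "M \<in> obj X \<Longrightarrow>
    \<ss> M \<cdot> \<ell> M = pairing X (\<T> (\<rho>\<^sub>0 M)) (\<T> (\<rho>\<^sub>1 M)) (\<rho>\<^sub>0 M \<cdot> \<ell> M) (\<rho>\<^sub>1 M \<cdot> \<ell> M) \<cdot> \<T> (\<ss> M)"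
  using lift_additive[of M]
  by (simp add: additive_bundle_morphism_def tangent_bundle_def tan_bundle_image_def)

text \<open>The flip exchanges the two projections of \<open>T\<^sup>2(M)\<close> and fixes the lift, so both projections
  agree on the lift.\<close>

lemma lift_proj:
  assumes "M \<in> obj X"
  shows "\<ell> M \<cdot> \<p> (\<T>\<^sub>o M) = \<p> M \<cdot> \<zero> M"
proof -
  have "\<c> M \<cdot> \<p> (\<T>\<^sub>o M) = \<T> (\<p> M)"
    using flip_additive[of M] assms
    by (simp add: additive_bundle_morphism_def tangent_bundle_def tan_bundle_image_def)
  then have "(\<ell> M \<cdot> \<c> M) \<cdot> \<p> (\<T>\<^sub>o M) = \<ell> M \<cdot> \<T> (\<p> M)"
    using assms by simp
  then show ?thesis
    by (simp only: lift_flip[OF assms] lift_tan_proj[OF assms])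
qed

lemma add_proj:
  assumes "M \<in> obj X"
  shows "\<ss> M \<cdot> \<p> M = \<rho>\<^sub>0 M \<cdot> \<p> M"
  using tangent_additive[of M] assms
  by (simp add: additive_bundle_def tangent_bundle_def Let_def)

lemma T2_proj_eq: "M \<in> obj X \<Longrightarrow> \<rho>\<^sub>0 M \<cdot> \<p> M = \<rho>\<^sub>1 M \<cdot> \<p> M"
  using T2_pullback[of M] by (simp add: is_pullback_def)

lemma add_zero_left:
  assumes "M \<in> obj X" "a \<in> hom X Y (\<T>\<^sub>o M)"
  shows "pairing X (\<rho>\<^sub>0 M) (\<rho>\<^sub>1 M) (a \<cdot> \<p> M \<cdot> \<zero> M) a \<cdot> \<ss> M = a"
    and add_zero_right: "pairing X (\<rho>\<^sub>0 M) (\<rho>\<^sub>1 M) a (a \<cdot> \<p> M \<cdot> \<zero> M) \<cdot> \<ss> M = a"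
  using tangent_additive[of M] assms
  by (simp_all del: cmp_assoc_arr add: additive_bundle_def tangent_bundle_def Let_def)

text \<open>The functor \<open>T\<close> preserves the pullback \<open>T\<^sub>2(M)\<close>, because it preserves the second fibre
  power of the projection.\<close>

lemma fibre_power_two_iff:
  assumes "f \<in> arr X"
  shows "is_fibre_power X 2 f P r q \<longleftrightarrow> is_pullback X f f P (q 0) (q 1) \<and> r = q 0 \<cdot> f"
proof -
  have two: "(\<forall>i<2. R i) \<longleftrightarrow> R 0 \<and> R 1" for R :: "nat \<Rightarrow> bool"
    by (auto simp: less_2_cases_iff)
  \<comment> \<open>The structure map \<open>r\<close> puts no condition on a cone beyond the one on its first leg.\<close>
  have cone: "h \<in> hom X Y P \<and> h \<cdot> r = b \<and> h \<cdot> q 0 = a\<^sub>0 \<and> h \<cdot> q 1 = a\<^sub>1 \<longleftrightarrow>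
      h \<in> hom X Y P \<and> h \<cdot> q 0 = a\<^sub>0 \<and> h \<cdot> q 1 = a\<^sub>1"
    if q: "q 0 \<in> hom X P (src X f)" "r = q 0 \<cdot> f" and a: "a\<^sub>0 \<cdot> f = b" for h Y b a\<^sub>0 a\<^sub>1
  proof -
    have "h \<cdot> r = (h \<cdot> q 0) \<cdot> f" if "h \<in> hom X Y P"
      using that q assms by simp
    then show ?thesis using a by blast
  qed
  show ?thesis
  proof
    assume fp: "is_fibre_power X 2 f P r q"
    then have q: "q 0 \<in> hom X P (src X f)" "q 1 \<in> hom X P (src X f)" "q 0 \<cdot> f = r" "q 1 \<cdot> f = r"
      unfolding is_fibre_power_def two by blast+
    have univ: "\<exists>!h. h \<in> hom X Y P \<and> h \<cdot> q 0 = a \<and> h \<cdot> q 1 = b"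
      if ab: "a \<in> hom X Y (src X f)" "b \<in> hom X Y (src X f)" "a \<cdot> f = b \<cdot> f" for Y a b
    proof -
      let ?a = "\<lambda>i::nat. if i = 0 then a else b"
      have base: "a \<cdot> f \<in> hom X Y (tgt X f)"
        using ab(1) assms by simp
      have legs: "(?a 0 \<in> hom X Y (src X f) \<and> ?a 0 \<cdot> f = a \<cdot> f) \<and>
          (?a 1 \<in> hom X Y (src X f) \<and> ?a 1 \<cdot> f = a \<cdot> f)"
        using ab by simp
      have "\<forall>Y b. \<forall>a :: nat \<Rightarrow> _. b \<in> hom X Y (tgt X f) \<longrightarrow>
          (a 0 \<in> hom X Y (src X f) \<and> a 0 \<cdot> f = b) \<and> (a 1 \<in> hom X Y (src X f) \<and> a 1 \<cdot> f = b) \<longrightarrow>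
          (\<exists>!h. h \<in> hom X Y P \<and> h \<cdot> r = b \<and> h \<cdot> q 0 = a 0 \<and> h \<cdot> q 1 = a 1)"
        using fp unfolding is_fibre_power_def two by (elim conjE)
      from this[THEN spec, THEN spec, THEN spec, THEN mp, THEN mp, OF base legs]
      have "\<exists>!h. h \<in> hom X Y P \<and> h \<cdot> r = a \<cdot> f \<and> h \<cdot> q 0 = a \<and> h \<cdot> q 1 = b"
        by (simp del: hom_iff)
      then show ?thesis
        unfolding cone[OF q(1) q(3)[symmetric] refl] .
    qed
    show "is_pullback X f f P (q 0) (q 1) \<and> r = q 0 \<cdot> f"
      unfolding is_pullback_def q(3,4)
      by (intro conjI allI impI refl assms q(1,2)) (rule univ)
  next
    assume pb: "is_pullback X f f P (q 0) (q 1) \<and> r = q 0 \<cdot> f"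
    then have q: "q 0 \<in> hom X P (src X f)" "q 1 \<in> hom X P (src X f)" "q 0 \<cdot> f = r" "q 1 \<cdot> f = r"
      unfolding is_pullback_def by (simp_all del: hom_iff)
    have univ: "\<exists>!h. h \<in> hom X Y P \<and> h \<cdot> r = b \<and> h \<cdot> q 0 = a 0 \<and> h \<cdot> q 1 = a 1"
      if ab: "b \<in> hom X Y (tgt X f)" "a 0 \<in> hom X Y (src X f) \<and> a 0 \<cdot> f = b"
        "a 1 \<in> hom X Y (src X f) \<and> a 1 \<cdot> f = b" for Y b and a :: "nat \<Rightarrow> _"
    proof -
      have e: "a 0 \<cdot> f = b" using ab(2) ..
      have e': "a 0 \<cdot> f = a 1 \<cdot> f" using ab by simp
      have "\<forall>Y a b. a \<in> hom X Y (src X f) \<longrightarrow> b \<in> hom X Y (src X f) \<longrightarrow> a \<cdot> f = b \<cdot> f \<longrightarrow>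
          (\<exists>!h. h \<in> hom X Y P \<and> h \<cdot> q 0 = a \<and> h \<cdot> q 1 = b)"
        using pb unfolding is_pullback_def by (elim conjE)
      from this[rule_format, OF conjunct1[OF ab(2)] conjunct1[OF ab(3)] e'] show ?thesis
        unfolding cone[OF q(1) q(3)[symmetric] e] .
    qed
    have r: "r \<in> hom X P (tgt X f)"
      unfolding q(3)[symmetric] using q(1) assms by simp
    show "is_fibre_power X 2 f P r q"
      unfolding is_fibre_power_def two
      by (intro conjI allI impI; (elim conjE)?; (rule assms r q univ)?; (intro conjI)?; assumption?)
  qed
qed

lemma tan_T2_pullback:
  assumes "M \<in> obj X"
  shows "is_pullback X (\<T> (\<p> M)) (\<T> (\<p> M)) (\<T>\<^sub>o (T2 X M)) (\<T> (\<rho>\<^sub>0 M)) (\<T> (\<rho>\<^sub>1 M))"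
proof -
  let ?q = "\<lambda>i::nat. if i = 0 then \<rho>\<^sub>0 M else \<rho>\<^sub>1 M"
  have "is_fibre_power X 2 (\<p> M) (T2 X M) (\<rho>\<^sub>0 M \<cdot> \<p> M) ?q"
    using T2_pullback[OF assms] assms by (simp add: fibre_power_two_iff)
  from fibre_power_preserved[OF assms this] show ?thesis
    using assms by (simp add: fibre_power_two_iff)
qed

abbreviation T2_pair where "T2_pair M \<equiv> pairing X (\<rho>\<^sub>0 M) (\<rho>\<^sub>1 M)"

abbreviation tan_T2_pair where "tan_T2_pair M \<equiv> pairing X (\<T> (\<rho>\<^sub>0 M)) (\<T> (\<rho>\<^sub>1 M))"

lemma T2_pair_universal:
  assumes "M \<in> obj X" "a \<in> hom X Y (\<T>\<^sub>o M)" "b \<in> hom X Y (\<T>\<^sub>o M)" "a \<cdot> \<p> M = b \<cdot> \<p> M"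
  shows "T2_pair M a b \<in> hom X Y (T2 X M)" "T2_pair M a b \<cdot> \<rho>\<^sub>0 M = a" "T2_pair M a b \<cdot> \<rho>\<^sub>1 M = b"
  using pairing_pullback[OF T2_pullback[OF assms(1)], of a Y b] assms by simp_all

lemma T2_ext:
  assumes "M \<in> obj X" "h \<in> hom X Y (T2 X M)" "h' \<in> hom X Y (T2 X M)"
    "h \<cdot> \<rho>\<^sub>0 M = h' \<cdot> \<rho>\<^sub>0 M" "h \<cdot> \<rho>\<^sub>1 M = h' \<cdot> \<rho>\<^sub>1 M"
  shows "h = h'"
  by (rule pullback_ext[OF T2_pullback[OF assms(1)] assms(2-5)])

lemma tan_T2_pair_universal:
  assumes "M \<in> obj X" "a \<in> hom X Y (\<T>\<^sub>o (\<T>\<^sub>o M))" "b \<in> hom X Y (\<T>\<^sub>o (\<T>\<^sub>o M))"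
    "a \<cdot> \<T> (\<p> M) = b \<cdot> \<T> (\<p> M)"
  shows "tan_T2_pair M a b \<in> hom X Y (\<T>\<^sub>o (T2 X M))" "tan_T2_pair M a b \<cdot> \<T> (\<rho>\<^sub>0 M) = a"
    "tan_T2_pair M a b \<cdot> \<T> (\<rho>\<^sub>1 M) = b"
  using pairing_pullback[OF tan_T2_pullback[OF assms(1)], of a Y b] assms by simp_all

lemma tan_T2_ext:
  assumes "M \<in> obj X" "h \<in> hom X Y (\<T>\<^sub>o (T2 X M))" "h' \<in> hom X Y (\<T>\<^sub>o (T2 X M))"
    "h \<cdot> \<T> (\<rho>\<^sub>0 M) = h' \<cdot> \<T> (\<rho>\<^sub>0 M)" "h \<cdot> \<T> (\<rho>\<^sub>1 M) = h' \<cdot> \<T> (\<rho>\<^sub>1 M)"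
  shows "h = h'"
  by (rule pullback_ext[OF tan_T2_pullback[OF assms(1)] assms(2-5)])

lemma T2_obj [simp]: "M \<in> obj X \<Longrightarrow> T2 X M \<in> obj X"
  using src_obj[of "\<rho>\<^sub>0 M"] by simp

lemma cmp_tan_T2_pair:
  assumes "M \<in> obj X" "a \<in> hom X Y (\<T>\<^sub>o (\<T>\<^sub>o M))" "b \<in> hom X Y (\<T>\<^sub>o (\<T>\<^sub>o M))"
    "a \<cdot> \<T> (\<p> M) = b \<cdot> \<T> (\<p> M)" "h \<in> hom X Y' Y"
  shows "h \<cdot> tan_T2_pair M a b = tan_T2_pair M (h \<cdot> a) (h \<cdot> b)"
proof -
  have "h \<cdot> (a \<cdot> \<T> (\<p> M)) = h \<cdot> (b \<cdot> \<T> (\<p> M))"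
    by (simp only: assms(4))
  then have e: "(h \<cdot> a) \<cdot> \<T> (\<p> M) = (h \<cdot> b) \<cdot> \<T> (\<p> M)"
    using assms(1,2,3,5) by simp
  have ha: "h \<cdot> a \<in> hom X Y' (\<T>\<^sub>o (\<T>\<^sub>o M))" and hb: "h \<cdot> b \<in> hom X Y' (\<T>\<^sub>o (\<T>\<^sub>o M))"
    using assms(1,2,3,5) by simp_all
  note U = tan_T2_pair_universal[OF assms(1-4)] and U' = tan_T2_pair_universal[OF assms(1) ha hb e]
  show ?thesis
    by (rule tan_T2_ext[OF assms(1) _ U'(1)]) (use assms(1,5) U(1) in \<open>simp_all add: U(2,3) U'(2,3)\<close>)
qed

text \<open>The map \<open>(a, b) \<mapsto> a\<ell> + b0\<close>, with the sum formed by \<open>T(+)\<close>, whose universal instance is the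
  equalizer in the axiom on the vertical lift. The lemmas below turn that axiom into statements
  about generalized elements.\<close>

abbreviation pair_lift where
  "pair_lift M a b \<equiv> tan_T2_pair M (a \<cdot> \<ell> M) (b \<cdot> \<zero> (\<T>\<^sub>o M)) \<cdot> \<T> (\<ss> M)"

text \<open>Both summands lie over the zero vector at the common base point, so their sum makes sense.\<close>

lemma lift_zero_base:
  assumes "M \<in> obj X" "a \<in> hom X Y (\<T>\<^sub>o M)" "b \<in> hom X Y (\<T>\<^sub>o M)" "a \<cdot> \<p> M = b \<cdot> \<p> M"
  shows "(a \<cdot> \<ell> M) \<cdot> \<T> (\<p> M) = (b \<cdot> \<zero> (\<T>\<^sub>o M)) \<cdot> \<T> (\<p> M)"
proof -
  have "(b \<cdot> \<zero> (\<T>\<^sub>o M)) \<cdot> \<T> (\<p> M) = (b \<cdot> \<p> M) \<cdot> \<zero> M"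
    using assms(1,3) zero_nat_arr[of "\<p> M" M] by simp
  also have "\<dots> = (a \<cdot> \<p> M) \<cdot> \<zero> M"
    by (simp only: assms(4))
  also have "\<dots> = (a \<cdot> \<ell> M) \<cdot> \<T> (\<p> M)"
    using assms(1,2) by (simp add: lift_tan_proj)
  finally show ?thesis ..
qed

lemma pair_lift_hom:
  assumes "M \<in> obj X" "a \<in> hom X Y (\<T>\<^sub>o M)" "b \<in> hom X Y (\<T>\<^sub>o M)" "a \<cdot> \<p> M = b \<cdot> \<p> M"
  shows "pair_lift M a b \<in> hom X Y (\<T>\<^sub>o (\<T>\<^sub>o M))"
  using tan_T2_pair_universal(1)[OF assms(1) _ _ lift_zero_base[OF assms], of Y] assms by simp

lemma pair_lift_eq:
  assumes "M \<in> obj X" "a \<in> hom X Y (\<T>\<^sub>o M)" "b \<in> hom X Y (\<T>\<^sub>o M)" "a \<cdot> \<p> M = b \<cdot> \<p> M"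
  shows "T2_pair M a b \<cdot> pair_lift M (\<rho>\<^sub>0 M) (\<rho>\<^sub>1 M) = pair_lift M a b"
proof -
  note U = T2_pair_universal[OF assms]
  have base: "(\<rho>\<^sub>0 M \<cdot> \<ell> M) \<cdot> \<T> (\<p> M) = (\<rho>\<^sub>1 M \<cdot> \<zero> (\<T>\<^sub>o M)) \<cdot> \<T> (\<p> M)"
    by (rule lift_zero_base) (use assms(1) T2_proj_eq in simp_all)
  have "T2_pair M a b \<cdot> pair_lift M (\<rho>\<^sub>0 M) (\<rho>\<^sub>1 M) =
      (T2_pair M a b \<cdot> tan_T2_pair M (\<rho>\<^sub>0 M \<cdot> \<ell> M) (\<rho>\<^sub>1 M \<cdot> \<zero> (\<T>\<^sub>o M))) \<cdot> \<T> (\<ss> M)"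
    using tan_T2_pair_universal(1)[OF assms(1) _ _ base, of "T2 X M"] U(1) assms(1) by simp
  also have "\<dots> = tan_T2_pair M (T2_pair M a b \<cdot> (\<rho>\<^sub>0 M \<cdot> \<ell> M)) (T2_pair M a b \<cdot> (\<rho>\<^sub>1 M \<cdot> \<zero> (\<T>\<^sub>o M))) \<cdot> \<T> (\<ss> M)"
    by (subst cmp_tan_T2_pair[OF assms(1) _ _ base U(1)]) (use assms(1) in simp_all)
  also have "T2_pair M a b \<cdot> (\<rho>\<^sub>0 M \<cdot> \<ell> M) = a \<cdot> \<ell> M"
    using U(1) assms(1) by (subst cmp_assoc_arr[symmetric]) (simp_all add: U(2))
  also have "T2_pair M a b \<cdot> (\<rho>\<^sub>1 M \<cdot> \<zero> (\<T>\<^sub>o M)) = b \<cdot> \<zero> (\<T>\<^sub>o M)"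
    using U(1) assms(1) by (subst cmp_assoc_arr[symmetric]) (simp_all add: U(3))
  finally show ?thesis .
qed

text \<open>The projection \<open>p\<close> kills the lifted summand, so it recovers the second vector.\<close>

lemma pair_lift_proj:
  assumes "M \<in> obj X" "a \<in> hom X Y (\<T>\<^sub>o M)" "b \<in> hom X Y (\<T>\<^sub>o M)" "a \<cdot> \<p> M = b \<cdot> \<p> M"
  shows "pair_lift M a b \<cdot> \<p> (\<T>\<^sub>o M) = b"
proof -
  let ?t = "tan_T2_pair M (a \<cdot> \<ell> M) (b \<cdot> \<zero> (\<T>\<^sub>o M))"
  have t: "?t \<in> hom X Y (\<T>\<^sub>o (T2 X M))" "?t \<cdot> \<T> (\<rho>\<^sub>0 M) = a \<cdot> \<ell> M"
    "?t \<cdot> \<T> (\<rho>\<^sub>1 M) = b \<cdot> \<zero> (\<T>\<^sub>o M)"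
    using tan_T2_pair_universal[OF assms(1) _ _ lift_zero_base[OF assms], of Y] assms by simp_all
  have c: "(b \<cdot> \<p> M \<cdot> \<zero> M) \<cdot> \<p> M = b \<cdot> \<p> M"
    using assms by simp
  have bz: "b \<cdot> \<p> M \<cdot> \<zero> M \<in> hom X Y (\<T>\<^sub>o M)"
    using assms by simp
  note U = T2_pair_universal[OF assms(1) bz assms(3) c]
  have "?t \<cdot> \<p> (T2 X M) = T2_pair M (b \<cdot> \<p> M \<cdot> \<zero> M) b"
  proof (rule T2_ext[OF assms(1) _ U(1)])
    show "?t \<cdot> \<p> (T2 X M) \<in> hom X Y (T2 X M)"
      using t(1) assms(1) by simp
    have "(?t \<cdot> \<p> (T2 X M)) \<cdot> \<rho>\<^sub>0 M = (?t \<cdot> \<T> (\<rho>\<^sub>0 M)) \<cdot> \<p> (\<T>\<^sub>o M)"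
      using t(1) assms(1) proj_nat_arr[of "\<rho>\<^sub>0 M" "\<T>\<^sub>o M"] by simp
    also have "\<dots> = (a \<cdot> \<p> M) \<cdot> \<zero> M"
      unfolding t(2) using assms(1,2) by (simp add: lift_proj)
    finally show "(?t \<cdot> \<p> (T2 X M)) \<cdot> \<rho>\<^sub>0 M = T2_pair M (b \<cdot> \<p> M \<cdot> \<zero> M) b \<cdot> \<rho>\<^sub>0 M"
      by (simp only: U(2) assms(4))
    have "(?t \<cdot> \<p> (T2 X M)) \<cdot> \<rho>\<^sub>1 M = (?t \<cdot> \<T> (\<rho>\<^sub>1 M)) \<cdot> \<p> (\<T>\<^sub>o M)"
      using t(1) assms(1) proj_nat_arr[of "\<rho>\<^sub>1 M" "\<T>\<^sub>o M"] by simp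
    also have "\<dots> = b"
      unfolding t(3) using assms(1,3) by simp
    finally show "(?t \<cdot> \<p> (T2 X M)) \<cdot> \<rho>\<^sub>1 M = T2_pair M (b \<cdot> \<p> M \<cdot> \<zero> M) b \<cdot> \<rho>\<^sub>1 M"
      by (simp only: U(3))
  qed
  moreover have "pair_lift M a b \<cdot> \<p> (\<T>\<^sub>o M) = (?t \<cdot> \<p> (T2 X M)) \<cdot> \<ss> M"
    using t(1) assms(1) proj_nat_arr[of "\<ss> M" "\<T>\<^sub>o M"] by simp
  ultimately show ?thesis
    by (simp only: add_zero_left[OF assms(1,3)])
qed

text \<open>Equalizers are monic, so the map into \<open>T\<^sub>2(M)\<close> and with it the lifted vector are determined.\<close>

lemma pair_lift_inj:
  assumes "M \<in> obj X" "a \<in> hom X Y (\<T>\<^sub>o M)" "a' \<in> hom X Y (\<T>\<^sub>o M)" "b \<in> hom X Y (\<T>\<^sub>o M)"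
    "a \<cdot> \<p> M = b \<cdot> \<p> M" "a' \<cdot> \<p> M = b \<cdot> \<p> M" "pair_lift M a b = pair_lift M a' b"
  shows "a = a'"
proof -
  let ?e = "pair_lift M (\<rho>\<^sub>0 M) (\<rho>\<^sub>1 M)" and ?h = "pair_lift M a b"
  note eq = lift_universal[OF assms(1), unfolded is_equalizer_def]
  note U = T2_pair_universal[OF assms(1,2,4,5)] and U' = T2_pair_universal[OF assms(1,3,4,6)]
  note E = pair_lift_eq[OF assms(1,2,4,5)] and E' = pair_lift_eq[OF assms(1,3,4,6)]
  have e: "?e \<in> hom X (T2 X M) (\<T>\<^sub>o (\<T>\<^sub>o M))"
    using eq assms(1) by simp
  have "\<exists>!h. h \<in> hom X Y (T2 X M) \<and> h \<cdot> ?e = ?h"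
  proof -
    have "?e \<cdot> \<T> (\<p> M) = ?e \<cdot> (\<T> (\<p> M) \<cdot> \<p> M \<cdot> \<zero> M)"
      using eq by blast
    then have "T2_pair M a b \<cdot> (?e \<cdot> \<T> (\<p> M)) = T2_pair M a b \<cdot> (?e \<cdot> (\<T> (\<p> M) \<cdot> \<p> M \<cdot> \<zero> M))"
      by (rule arg_cong)
    then have "(T2_pair M a b \<cdot> ?e) \<cdot> \<T> (\<p> M) = (T2_pair M a b \<cdot> ?e) \<cdot> (\<T> (\<p> M) \<cdot> \<p> M \<cdot> \<zero> M)"
      using cmp_assoc[OF U(1) e, of "\<T> (\<p> M)" "\<T>\<^sub>o M"]
        cmp_assoc[OF U(1) e, of "\<T> (\<p> M) \<cdot> \<p> M \<cdot> \<zero> M" "\<T>\<^sub>o M"] assms(1)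
      by (simp del: cmp_assoc_arr)
    moreover have "?h \<in> hom X Y (src X (\<T> (\<p> M)))"
      using pair_lift_hom[OF assms(1,2,4,5)] assms(1) by simp
    ultimately show ?thesis
      using eq unfolding E by blast
  qed
  then have "T2_pair M a b = T2_pair M a' b"
    using U(1) U'(1) E E' assms(7) by (metis (no_types, lifting))
  then have "T2_pair M a b \<cdot> \<rho>\<^sub>0 M = T2_pair M a' b \<cdot> \<rho>\<^sub>0 M"
    by (rule arg_cong)
  then show ?thesis
    unfolding U(2) U'(2) .
qed

text \<open>Every element of the equalizer comes from a pair, whose second entry has to be \<open>hp\<close> by
  \<open>pair_lift_proj\<close>.\<close>

lemma pair_lift_surj:
  assumes "M \<in> obj X" "h \<in> hom X Y (\<T>\<^sub>o (\<T>\<^sub>o M))"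
    "h \<cdot> \<T> (\<p> M) = h \<cdot> (\<T> (\<p> M) \<cdot> \<p> M \<cdot> \<zero> M)"
  obtains a where "a \<in> hom X Y (\<T>\<^sub>o M)" "a \<cdot> \<p> M = h \<cdot> \<p> (\<T>\<^sub>o M) \<cdot> \<p> M"
    "h = pair_lift M a (h \<cdot> \<p> (\<T>\<^sub>o M))"
proof -
  let ?e = "pair_lift M (\<rho>\<^sub>0 M) (\<rho>\<^sub>1 M)"
  have "h \<in> hom X Y (src X (\<T> (\<p> M)))"
    using assms(1,2) by simp
  then obtain t where t: "t \<in> hom X Y (T2 X M)" "t \<cdot> ?e = h"
    using lift_universal[OF assms(1), unfolded is_equalizer_def] assms(3) by blast
  let ?a = "t \<cdot> \<rho>\<^sub>0 M" and ?b = "t \<cdot> \<rho>\<^sub>1 M"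
  have a: "?a \<in> hom X Y (\<T>\<^sub>o M)" and b: "?b \<in> hom X Y (\<T>\<^sub>o M)" and ab: "?a \<cdot> \<p> M = ?b \<cdot> \<p> M"
    using t(1) assms(1) T2_proj_eq[OF assms(1)] by simp_all
  have "t = T2_pair M ?a ?b"
    using T2_pair_universal[OF assms(1) a b ab] by (intro T2_ext[OF assms(1) t(1)]) simp_all
  then have h: "h = pair_lift M ?a ?b"
    using t(2) pair_lift_eq[OF assms(1) a b ab] by simp
  then have "h \<cdot> \<p> (\<T>\<^sub>o M) = ?b"
    using pair_lift_proj[OF assms(1) a b ab] by simp
  with that[OF a] ab h show ?thesis
    by simp
qed

text \<open>The lift is additive and sends the zero vector \<open>0\<close> to \<open>00\<close>, so it turns the unit law \<open>a + 0 = a\<close>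
  into this equation.\<close>

lemma pair_lift_zero:
  assumes "M \<in> obj X" "a \<in> hom X Y (\<T>\<^sub>o M)"
  shows "pair_lift M a (a \<cdot> \<p> M \<cdot> \<zero> M) = a \<cdot> \<ell> M"
proof -
  let ?z = "a \<cdot> \<p> M \<cdot> \<zero> M"
  have z: "?z \<in> hom X Y (\<T>\<^sub>o M)" "a \<cdot> \<p> M = ?z \<cdot> \<p> M"
    using assms by simp_all
  note U = T2_pair_universal[OF assms z]
  have r: "\<rho>\<^sub>0 M \<cdot> \<ell> M \<in> hom X (T2 X M) (\<T>\<^sub>o (\<T>\<^sub>o M))" "\<rho>\<^sub>1 M \<cdot> \<ell> M \<in> hom X (T2 X M) (\<T>\<^sub>o (\<T>\<^sub>o M))"
    "(\<rho>\<^sub>0 M \<cdot> \<ell> M) \<cdot> \<T> (\<p> M) = (\<rho>\<^sub>1 M \<cdot> \<ell> M) \<cdot> \<T> (\<p> M)"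
  proof -
    have "(\<rho>\<^sub>0 M \<cdot> \<p> M) \<cdot> \<zero> M = (\<rho>\<^sub>1 M \<cdot> \<p> M) \<cdot> \<zero> M"
      by (simp only: T2_proj_eq[OF assms(1)])
    then show "(\<rho>\<^sub>0 M \<cdot> \<ell> M) \<cdot> \<T> (\<p> M) = (\<rho>\<^sub>1 M \<cdot> \<ell> M) \<cdot> \<T> (\<p> M)"
      using assms(1) by (simp add: lift_tan_proj)
  qed (use assms(1) in simp_all)
  have "a \<cdot> \<ell> M = (T2_pair M a ?z \<cdot> \<ss> M) \<cdot> \<ell> M"
    by (simp only: add_zero_right[OF assms])
  also have "\<dots> = T2_pair M a ?z \<cdot> (\<ss> M \<cdot> \<ell> M)"
    using U(1) assms(1) by simp
  also have "\<dots> = (T2_pair M a ?z \<cdot> tan_T2_pair M (\<rho>\<^sub>0 M \<cdot> \<ell> M) (\<rho>\<^sub>1 M \<cdot> \<ell> M)) \<cdot> \<T> (\<ss> M)"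
    unfolding add_lift[OF assms(1)]
    using tan_T2_pair_universal(1)[OF assms(1) r] U(1) assms(1) by simp
  also have "\<dots> = tan_T2_pair M (T2_pair M a ?z \<cdot> (\<rho>\<^sub>0 M \<cdot> \<ell> M)) (T2_pair M a ?z \<cdot> (\<rho>\<^sub>1 M \<cdot> \<ell> M)) \<cdot> \<T> (\<ss> M)"
    by (simp only: cmp_tan_T2_pair[OF assms(1) r U(1)])
  also have "T2_pair M a ?z \<cdot> (\<rho>\<^sub>0 M \<cdot> \<ell> M) = a \<cdot> \<ell> M"
    using U(1) assms(1) by (subst cmp_assoc_arr[symmetric]) (simp_all add: U(2))
  also have "T2_pair M a ?z \<cdot> (\<rho>\<^sub>1 M \<cdot> \<ell> M) = (T2_pair M a ?z \<cdot> \<rho>\<^sub>1 M) \<cdot> \<ell> M"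
    using U(1) assms(1) by simp
  also have "\<dots> = ?z \<cdot> \<zero> (\<T>\<^sub>o M)"
    unfolding U(3) using assms zero_lift[OF assms(1)] zero_nat_arr[of "\<zero> M" "\<T>\<^sub>o M"] by simp
  finally show ?thesis ..
qed

end

section \<open>Products and the tangent functor\<close>

context cartesian_tangent_category
begin

lemma unit_obj_in [simp]: "\<I> \<in> obj X"
  using unit_terminal by (simp add: is_terminal_def)

lemma bang_hom: "A \<in> obj X \<Longrightarrow> \<tau> A \<in> hom X A \<I>"
  using unit_terminal unfolding is_terminal_def bang_def by (metis theI')

lemma arr_bang [simp]:
  assumes "A \<in> obj X"
  shows "\<tau> A \<in> arr X" "src X (\<tau> A) = A" "tgt X (\<tau> A) = \<I>"
  using bang_hom[OF assms] by auto

lemma unit_ext: "f \<in> hom X Y \<I> \<Longrightarrow> g \<in> hom X Y \<I> \<Longrightarrow> f = g"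
  using unit_terminal src_obj[of f] unfolding is_terminal_def by (metis homD)

lemma cmp_bang [simp]: "f \<in> arr X \<Longrightarrow> tgt X f = A \<Longrightarrow> f \<cdot> \<tau> A = \<tau> (src X f)"
  by (rule unit_ext[of _ "src X f"]) auto

lemma cmp_bang_ext [simp]:
  assumes "f \<in> arr X" "tgt X f = A" "h \<in> arr X" "src X h = \<I>"
  shows "f \<cdot> (\<tau> A \<cdot> h) = \<tau> (src X f) \<cdot> h"
proof -
  have "f \<cdot> (\<tau> A \<cdot> h) = (f \<cdot> \<tau> A) \<cdot> h"
    using assms by (subst cmp_assoc_arr) auto
  then show ?thesis using assms by simp
qed

text \<open>The object \<open>T(1)\<close> is isomorphic to \<open>1\<close>, hence terminal.\<close>

lemma tan_unit_ext:
  assumes "f \<in> hom X Y (\<T>\<^sub>o \<I>)" "g \<in> hom X Y (\<T>\<^sub>o \<I>)"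
  shows "f = g"
proof -
  obtain j where j: "inverse_arrows X (\<tau> (\<T>\<^sub>o \<I>)) j"
    using tan_unit_iso by (auto simp: iso_def)
  then have J: "j \<in> arr X" "src X j = \<I>" "\<tau> (\<T>\<^sub>o \<I>) \<cdot> j = \<one> (\<T>\<^sub>o \<I>)"
    by (auto simp: inverse_arrows_def)
  have "h = \<tau> Y \<cdot> j" if "h \<in> hom X Y (\<T>\<^sub>o \<I>)" for h
    using that J by (metis cmp_bang_ext cmp_idn homD)
  then show ?thesis using assms by metis
qed

lemma prd_obj [simp]: "A \<in> obj X \<Longrightarrow> B \<in> obj X \<Longrightarrow> A \<times>\<^sub>o B \<in> obj X"
  using prd_product[of A B] src_obj unfolding is_product_def by (metis homD(1,2))

lemma arr_prd_proj [simp]: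
  assumes "A \<in> obj X" "B \<in> obj X"
  shows "\<pi>\<^sub>0 A B \<in> arr X" "src X (\<pi>\<^sub>0 A B) = A \<times>\<^sub>o B" "tgt X (\<pi>\<^sub>0 A B) = A"
    "\<pi>\<^sub>1 A B \<in> arr X" "src X (\<pi>\<^sub>1 A B) = A \<times>\<^sub>o B" "tgt X (\<pi>\<^sub>1 A B) = B"
  using prd_product[OF assms] unfolding is_product_def by auto

lemma pair_universal:
  assumes "f \<in> arr X" "g \<in> arr X" "src X f = src X g"
  shows "\<langle>f, g\<rangle> \<in> hom X (src X f) (tgt X f \<times>\<^sub>o tgt X g)"
    "\<langle>f, g\<rangle> \<cdot> \<pi>\<^sub>0 (tgt X f) (tgt X g) = f" "\<langle>f, g\<rangle> \<cdot> \<pi>\<^sub>1 (tgt X f) (tgt X g) = g"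
proof -
  let ?A = "tgt X f" and ?B = "tgt X g"
  have "\<exists>!h. h \<in> hom X (src X f) (?A \<times>\<^sub>o ?B) \<and> h \<cdot> \<pi>\<^sub>0 ?A ?B = f \<and> h \<cdot> \<pi>\<^sub>1 ?A ?B = g"
    using prd_product[of ?A ?B] assms(1,2) homI[OF assms(1) refl refl]
      homI[OF assms(2) assms(3)[symmetric] refl]
    unfolding is_product_def by (blast intro: tgt_obj)
  from theI'[OF this] show "\<langle>f, g\<rangle> \<in> hom X (src X f) (tgt X f \<times>\<^sub>o tgt X g)"
    "\<langle>f, g\<rangle> \<cdot> \<pi>\<^sub>0 (tgt X f) (tgt X g) = f" "\<langle>f, g\<rangle> \<cdot> \<pi>\<^sub>1 (tgt X f) (tgt X g) = g"
    using assms unfolding pair_def pairing_def by auto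
qed

lemma arr_pair [simp]:
  assumes "f \<in> arr X" "g \<in> arr X" "src X f = src X g"
  shows "\<langle>f, g\<rangle> \<in> arr X" "src X \<langle>f, g\<rangle> = src X f" "tgt X \<langle>f, g\<rangle> = tgt X f \<times>\<^sub>o tgt X g"
  using pair_universal[OF assms] by auto

lemma pair_proj [simp]:
  assumes "f \<in> arr X" "g \<in> arr X" "src X f = src X g" "tgt X f = A" "tgt X g = B"
  shows "\<langle>f, g\<rangle> \<cdot> \<pi>\<^sub>0 A B = f" "\<langle>f, g\<rangle> \<cdot> \<pi>\<^sub>1 A B = g"
  using pair_universal[OF assms(1,2,3)] assms by auto

lemma pair_proj_ext [simp]:
  assumes "f \<in> arr X" "g \<in> arr X" "src X f = src X g" "tgt X f = A" "tgt X g = B"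
    "A \<in> obj X" "B \<in> obj X" "h \<in> arr X"
  shows "src X h = A \<Longrightarrow> \<langle>f, g\<rangle> \<cdot> (\<pi>\<^sub>0 A B \<cdot> h) = f \<cdot> h"
    "src X h = B \<Longrightarrow> \<langle>f, g\<rangle> \<cdot> (\<pi>\<^sub>1 A B \<cdot> h) = g \<cdot> h"
  using assms by (simp_all flip: cmp_assoc_arr)

lemma prd_ext:
  assumes "h \<in> hom X Y (A \<times>\<^sub>o B)" "h' \<in> hom X Y (A \<times>\<^sub>o B)" "A \<in> obj X" "B \<in> obj X"
    "h \<cdot> \<pi>\<^sub>0 A B = h' \<cdot> \<pi>\<^sub>0 A B" "h \<cdot> \<pi>\<^sub>1 A B = h' \<cdot> \<pi>\<^sub>1 A B"
  shows "h = h'"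
proof -
  have "h \<cdot> \<pi>\<^sub>0 A B \<in> hom X Y A" "h \<cdot> \<pi>\<^sub>1 A B \<in> hom X Y B"
    using assms(1,3,4) by auto
  then show ?thesis
    using prd_product[OF assms(3,4)] assms unfolding is_product_def by metis
qed

lemma cmp_pair [simp]:
  assumes "f \<in> arr X" "g \<in> arr X" "src X f = src X g" "h \<in> arr X" "tgt X h = src X f"
  shows "h \<cdot> \<langle>f, g\<rangle> = \<langle>h \<cdot> f, h \<cdot> g\<rangle>"
  by (rule prd_ext[of _ "src X h" "tgt X f" "tgt X g"]) (use assms in auto)

lemma cmp_pair_ext [simp]:
  assumes "f \<in> arr X" "g \<in> arr X" "src X f = src X g" "h \<in> arr X" "tgt X h = src X f"
    "n \<in> arr X" "src X n = tgt X f \<times>\<^sub>o tgt X g"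
  shows "h \<cdot> (\<langle>f, g\<rangle> \<cdot> n) = \<langle>h \<cdot> f, h \<cdot> g\<rangle> \<cdot> n"
  using assms by (simp flip: cmp_assoc_arr)

lemma pair_projs [simp]: "A \<in> obj X \<Longrightarrow> B \<in> obj X \<Longrightarrow> \<langle>\<pi>\<^sub>0 A B, \<pi>\<^sub>1 A B\<rangle> = \<one> (A \<times>\<^sub>o B)"
  by (rule prd_ext[of _ "A \<times>\<^sub>o B" A B]) auto

lemma split_inverse [simp]:
  assumes "A \<in> obj X" "B \<in> obj X"
  shows "inv_arr X (\<sigma> A B) \<in> arr X" "src X (inv_arr X (\<sigma> A B)) = \<T>\<^sub>o A \<times>\<^sub>o \<T>\<^sub>o B"
    "tgt X (inv_arr X (\<sigma> A B)) = \<T>\<^sub>o (A \<times>\<^sub>o B)"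
    "\<langle>\<T> (\<pi>\<^sub>0 A B), \<T> (\<pi>\<^sub>1 A B)\<rangle> \<cdot> inv_arr X (\<sigma> A B) = \<one> (\<T>\<^sub>o (A \<times>\<^sub>o B))"
    "inv_arr X (\<sigma> A B) \<cdot> \<T> (\<pi>\<^sub>0 A B) = \<pi>\<^sub>0 (\<T>\<^sub>o A) (\<T>\<^sub>o B)"
    "inv_arr X (\<sigma> A B) \<cdot> \<T> (\<pi>\<^sub>1 A B) = \<pi>\<^sub>1 (\<T>\<^sub>o A) (\<T>\<^sub>o B)"
proof -
  let ?i = "inv_arr X (\<sigma> A B)"
  have inv: "inverse_arrows X (\<sigma> A B) ?i"
    by (rule iso_inverse[OF split_iso[OF assms]])
  then show i: "?i \<in> arr X" "src X ?i = \<T>\<^sub>o A \<times>\<^sub>o \<T>\<^sub>o B" "tgt X ?i = \<T>\<^sub>o (A \<times>\<^sub>o B)"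
    using assms by (auto simp: inverse_arrows_def tan_split_def)
  show "\<langle>\<T> (\<pi>\<^sub>0 A B), \<T> (\<pi>\<^sub>1 A B)\<rangle> \<cdot> ?i = \<one> (\<T>\<^sub>o (A \<times>\<^sub>o B))"
    using inv assms by (auto simp: inverse_arrows_def tan_split_def)
  have "?i \<cdot> \<sigma> A B = \<one> (\<T>\<^sub>o A \<times>\<^sub>o \<T>\<^sub>o B)"
    using inv assms by (auto simp: inverse_arrows_def tan_split_def)
  then have e: "\<langle>?i \<cdot> \<T> (\<pi>\<^sub>0 A B), ?i \<cdot> \<T> (\<pi>\<^sub>1 A B)\<rangle> = \<one> (\<T>\<^sub>o A \<times>\<^sub>o \<T>\<^sub>o B)"
    using assms i by (simp add: tan_split_def)
  show "?i \<cdot> \<T> (\<pi>\<^sub>0 A B) = \<pi>\<^sub>0 (\<T>\<^sub>o A) (\<T>\<^sub>o B)"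
    using arg_cong[OF e, of "\<lambda>h. h \<cdot> \<pi>\<^sub>0 (\<T>\<^sub>o A) (\<T>\<^sub>o B)"] assms i by simp
  show "?i \<cdot> \<T> (\<pi>\<^sub>1 A B) = \<pi>\<^sub>1 (\<T>\<^sub>o A) (\<T>\<^sub>o B)"
    using arg_cong[OF e, of "\<lambda>h. h \<cdot> \<pi>\<^sub>1 (\<T>\<^sub>o A) (\<T>\<^sub>o B)"] assms i by simp
qed

text \<open>\<open>T(A \<times> B)\<close> with the projections \<open>T(\<pi>\<^sub>0)\<close>, \<open>T(\<pi>\<^sub>1)\<close> is a product, so a pair of tangent vectors is
  one tangent vector of the product.\<close>

lemma tan_prd_point:
  assumes "a \<in> hom X Y (\<T>\<^sub>o A)" "b \<in> hom X Y (\<T>\<^sub>o B)" "A \<in> obj X" "B \<in> obj X"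
  obtains h where "h \<in> hom X Y (\<T>\<^sub>o (A \<times>\<^sub>o B))" "h \<cdot> \<T> (\<pi>\<^sub>0 A B) = a" "h \<cdot> \<T> (\<pi>\<^sub>1 A B) = b"
  by (rule that[of "\<langle>a, b\<rangle> \<cdot> inv_arr X (\<sigma> A B)"]) (use assms in auto)

lemma arr_tan_from_prd [simp]:
  assumes "f \<in> arr X" "src X f = A \<times>\<^sub>o B" "A \<in> obj X" "B \<in> obj X"
  shows "tan_from_prd X A B f \<in> arr X" "src X (tan_from_prd X A B f) = \<T>\<^sub>o A \<times>\<^sub>o \<T>\<^sub>o B"
    "tgt X (tan_from_prd X A B f) = \<T>\<^sub>o (tgt X f)"
  using assms by (auto simp: tan_from_prd_def)

text \<open>When both arguments of \<open>T(f)\<close> are images of one \<open>h\<close>, the identification of \<open>T(A) \<times> T(B)\<close> with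
  \<open>T(A \<times> B)\<close> disappears. Identities for \<open>f\<close> then pass to \<open>T(f)\<close> by functoriality.\<close>

lemma tan_from_prd_point:
  assumes "h \<in> hom X Y (\<T>\<^sub>o Z)" "x \<in> hom X Z A" "y \<in> hom X Z B" "f \<in> hom X (A \<times>\<^sub>o B) C"
    "A \<in> obj X" "B \<in> obj X"
  shows "\<langle>h \<cdot> \<T> x, h \<cdot> \<T> y\<rangle> \<cdot> tan_from_prd X A B f = h \<cdot> \<T> (\<langle>x, y\<rangle> \<cdot> f)"
proof -
  have "\<langle>h \<cdot> \<T> x, h \<cdot> \<T> y\<rangle> = (h \<cdot> \<T> \<langle>x, y\<rangle>) \<cdot> \<langle>\<T> (\<pi>\<^sub>0 A B), \<T> (\<pi>\<^sub>1 A B)\<rangle>"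
    using assms by (simp flip: tan_cmp_arr)
  then have "\<langle>h \<cdot> \<T> x, h \<cdot> \<T> y\<rangle> \<cdot> inv_arr X (\<sigma> A B) =
      ((h \<cdot> \<T> \<langle>x, y\<rangle>) \<cdot> \<langle>\<T> (\<pi>\<^sub>0 A B), \<T> (\<pi>\<^sub>1 A B)\<rangle>) \<cdot> inv_arr X (\<sigma> A B)"
    by simp
  also have "\<dots> = (h \<cdot> \<T> \<langle>x, y\<rangle>) \<cdot> (\<langle>\<T> (\<pi>\<^sub>0 A B), \<T> (\<pi>\<^sub>1 A B)\<rangle> \<cdot> inv_arr X (\<sigma> A B))"
    using assms by (subst cmp_assoc_arr) auto
  also have "\<dots> = h \<cdot> \<T> \<langle>x, y\<rangle>"
    using assms by (simp del: cmp_pair_ext)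
  finally have e: "\<langle>h \<cdot> \<T> x, h \<cdot> \<T> y\<rangle> \<cdot> inv_arr X (\<sigma> A B) = h \<cdot> \<T> \<langle>x, y\<rangle>" .
  have "\<langle>h \<cdot> \<T> x, h \<cdot> \<T> y\<rangle> \<cdot> tan_from_prd X A B f =
      (\<langle>h \<cdot> \<T> x, h \<cdot> \<T> y\<rangle> \<cdot> inv_arr X (\<sigma> A B)) \<cdot> \<T> f"
    using assms by (simp add: tan_from_prd_def)
  also have "\<dots> = h \<cdot> \<T> (\<langle>x, y\<rangle> \<cdot> f)"
    unfolding e using assms by simp
  finally show ?thesis .
qed

end

section \<open>The tangent group\<close>

context group_object
begin

lemma arr_group [simp]:
  "G \<in> obj X" "m \<in> arr X" "src X m = G \<times>\<^sub>o G" "tgt X m = G"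
  "u \<in> arr X" "src X u = \<I>" "tgt X u = G" "\<iota> \<in> arr X" "src X \<iota> = G" "tgt X \<iota> = G"
  using G_obj mult_hom unit_hom inv_hom by simp_all

lemma mult_point_assoc:
  assumes "a \<in> hom X Y G" "b \<in> hom X Y G" "d \<in> hom X Y G"
  shows "\<langle>\<langle>a, b\<rangle> \<cdot> m, d\<rangle> \<cdot> m = \<langle>a, \<langle>b, d\<rangle> \<cdot> m\<rangle> \<cdot> m"
  using arg_cong[OF mult_assoc, of "\<lambda>h. \<langle>\<langle>a, b\<rangle>, d\<rangle> \<cdot> h"] assms by (simp add: prd_arr_def)

lemma mult_point_unit:
  assumes "a \<in> hom X Y G"
  shows "\<langle>\<tau> Y \<cdot> u, a\<rangle> \<cdot> m = a" "\<langle>a, \<tau> Y \<cdot> u\<rangle> \<cdot> m = a"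
  using arg_cong[OF mult_unit_left, of "\<lambda>h. a \<cdot> h"] arg_cong[OF mult_unit_right, of "\<lambda>h. a \<cdot> h"]
    assms src_obj[of a] by simp_all

lemma mult_point_inv:
  assumes "a \<in> hom X Y G"
  shows "\<langle>a \<cdot> \<iota>, a\<rangle> \<cdot> m = \<tau> Y \<cdot> u" "\<langle>a, a \<cdot> \<iota>\<rangle> \<cdot> m = \<tau> Y \<cdot> u"
  using arg_cong[OF mult_inv_left, of "\<lambda>h. a \<cdot> h"] arg_cong[OF mult_inv_right, of "\<lambda>h. a \<cdot> h"]
    assms src_obj[of a] by simp_all

abbreviation tmult where "tmult \<equiv> tan_from_prd X G G m"

lemmas tmult_point = tan_from_prd_point[OF _ _ _ mult_hom G_obj G_obj]

text \<open>The map to \<open>T(1)\<close> can only be the zero vector, and \<open>T(u)\<close> preserves zero vectors.\<close>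

lemma tan_unit_point:
  assumes "h \<in> hom X Y (\<T>\<^sub>o Z)" "Z \<in> obj X"
  shows "h \<cdot> \<T> (\<tau> Z \<cdot> u) = \<tau> Y \<cdot> u \<cdot> \<zero> G"
proof -
  have Y: "Y \<in> obj X"
    using assms(1) src_obj[of h] by simp
  have "h \<cdot> \<T> (\<tau> Z) = \<tau> Y \<cdot> \<zero> \<I>"
    by (rule tan_unit_ext[of _ Y]) (use assms Y in simp_all)
  then have "(h \<cdot> \<T> (\<tau> Z)) \<cdot> \<T> u = (\<tau> Y \<cdot> \<zero> \<I>) \<cdot> \<T> u"
    by (rule arg_cong)
  then show ?thesis
    using assms Y zero_nat_arr[of u G] by simp
qed

text \<open>Three tangent vectors of \<open>G\<close> are the images of one tangent vector of \<open>(G \<times> G) \<times> G\<close> under \<open>T\<close> of the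
  three projections, for which associativity is \<open>T\<close> applied to the associativity of \<open>m\<close>.\<close>

lemma tmult_assoc:
  assumes "a \<in> hom X Y (\<T>\<^sub>o G)" "b \<in> hom X Y (\<T>\<^sub>o G)" "d \<in> hom X Y (\<T>\<^sub>o G)"
  shows "\<langle>\<langle>a, b\<rangle> \<cdot> tmult, d\<rangle> \<cdot> tmult = \<langle>a, \<langle>b, d\<rangle> \<cdot> tmult\<rangle> \<cdot> tmult"
proof -
  let ?Z = "(G \<times>\<^sub>o G) \<times>\<^sub>o G"
  obtain h\<^sub>0 where h\<^sub>0: "h\<^sub>0 \<in> hom X Y (\<T>\<^sub>o (G \<times>\<^sub>o G))" "h\<^sub>0 \<cdot> \<T> (\<pi>\<^sub>0 G G) = a" "h\<^sub>0 \<cdot> \<T> (\<pi>\<^sub>1 G G) = b"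
    using tan_prd_point[OF assms(1,2) G_obj G_obj] .
  obtain h where h: "h \<in> hom X Y (\<T>\<^sub>o ?Z)" "h \<cdot> \<T> (\<pi>\<^sub>0 (G \<times>\<^sub>o G) G) = h\<^sub>0"
    "h \<cdot> \<T> (\<pi>\<^sub>1 (G \<times>\<^sub>o G) G) = d"
    using tan_prd_point[OF h\<^sub>0(1) assms(3) _ G_obj] by auto
  define x y w where xyw: "x = \<pi>\<^sub>0 (G \<times>\<^sub>o G) G \<cdot> \<pi>\<^sub>0 G G" "y = \<pi>\<^sub>0 (G \<times>\<^sub>o G) G \<cdot> \<pi>\<^sub>1 G G"
    "w = \<pi>\<^sub>1 (G \<times>\<^sub>o G) G"
  have t: "x \<in> hom X ?Z G" "y \<in> hom X ?Z G" "w \<in> hom X ?Z G"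
    "\<langle>x, y\<rangle> \<cdot> m \<in> hom X ?Z G" "\<langle>y, w\<rangle> \<cdot> m \<in> hom X ?Z G"
    by (simp_all add: xyw)
  have abd: "a = h \<cdot> \<T> x" "b = h \<cdot> \<T> y" "d = h \<cdot> \<T> w"
    using h h\<^sub>0 by (auto simp: xyw simp flip: cmp_assoc_arr)
  show ?thesis
    unfolding abd tmult_point[OF h(1) t(1,2)] tmult_point[OF h(1) t(2,3)]
      tmult_point[OF h(1) t(1,5)] tmult_point[OF h(1) t(4,3)] mult_point_assoc[OF t(1,2,3)] ..
qed

lemma tmult_unit:
  assumes "a \<in> hom X Y (\<T>\<^sub>o G)"
  shows "\<langle>\<tau> Y \<cdot> u \<cdot> \<zero> G, a\<rangle> \<cdot> tmult = a" "\<langle>a, \<tau> Y \<cdot> u \<cdot> \<zero> G\<rangle> \<cdot> tmult = a"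
proof -
  have a: "a = a \<cdot> \<T> (\<one> G)" and t: "\<tau> G \<cdot> u \<in> hom X G G"
    using assms by simp_all
  show "\<langle>\<tau> Y \<cdot> u \<cdot> \<zero> G, a\<rangle> \<cdot> tmult = a"
    using tmult_point[OF assms t idn_hom[OF G_obj], unfolded mult_unit_left
        tan_unit_point[OF assms G_obj] a[symmetric]] .
  show "\<langle>a, \<tau> Y \<cdot> u \<cdot> \<zero> G\<rangle> \<cdot> tmult = a"
    using tmult_point[OF assms idn_hom[OF G_obj] t, unfolded mult_unit_right
        tan_unit_point[OF assms G_obj] a[symmetric]] .
qed

lemma tmult_inv:
  assumes "a \<in> hom X Y (\<T>\<^sub>o G)"
  shows "\<langle>a \<cdot> \<T> \<iota>, a\<rangle> \<cdot> tmult = \<tau> Y \<cdot> u \<cdot> \<zero> G" "\<langle>a, a \<cdot> \<T> \<iota>\<rangle> \<cdot> tmult = \<tau> Y \<cdot> u \<cdot> \<zero> G"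
proof -
  have a: "a = a \<cdot> \<T> (\<one> G)"
    using assms by simp
  show "\<langle>a \<cdot> \<T> \<iota>, a\<rangle> \<cdot> tmult = \<tau> Y \<cdot> u \<cdot> \<zero> G"
    using tmult_point[OF assms inv_hom idn_hom[OF G_obj], unfolded mult_inv_left
        tan_unit_point[OF assms G_obj] a[symmetric]] .
  show "\<langle>a, a \<cdot> \<T> \<iota>\<rangle> \<cdot> tmult = \<tau> Y \<cdot> u \<cdot> \<zero> G"
    using tmult_point[OF assms idn_hom[OF G_obj] inv_hom, unfolded mult_inv_right
        tan_unit_point[OF assms G_obj] a[symmetric]] .
qed

text \<open>As \<open>T(G)\<close> is again a group object, every fact proved here for \<open>T(m)\<close> also holds for the
  multiplication of \<open>T\<^sup>2(G)\<close>.\<close>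

lemma tangent_group: "group_object X (\<T>\<^sub>o G) tmult (u \<cdot> \<zero> G) (\<T> \<iota>)"
proof unfold_locales
  let ?T = "\<T>\<^sub>o G"
  show "\<T>\<^sub>o G \<in> obj X" "tmult \<in> hom X (?T \<times>\<^sub>o ?T) ?T" "u \<cdot> \<zero> G \<in> hom X \<I> ?T" "\<T> \<iota> \<in> hom X ?T ?T"
    by simp_all
  show "\<langle>\<tau> ?T \<cdot> (u \<cdot> \<zero> G), \<one> ?T\<rangle> \<cdot> tmult = \<one> ?T" "\<langle>\<one> ?T, \<tau> ?T \<cdot> (u \<cdot> \<zero> G)\<rangle> \<cdot> tmult = \<one> ?T"
    using tmult_unit[of "\<one> ?T" ?T] by simp_all
  show "\<langle>\<T> \<iota>, \<one> ?T\<rangle> \<cdot> tmult = \<tau> ?T \<cdot> (u \<cdot> \<zero> G)" "\<langle>\<one> ?T, \<T> \<iota>\<rangle> \<cdot> tmult = \<tau> ?T \<cdot> (u \<cdot> \<zero> G)"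
    using tmult_inv[of "\<one> ?T" ?T] by simp_all
  show "(tmult \<times>\<^sub>a \<one> ?T) \<cdot> tmult =
      \<langle>\<pi>\<^sub>0 (?T \<times>\<^sub>o ?T) ?T \<cdot> \<pi>\<^sub>0 ?T ?T, \<langle>\<pi>\<^sub>0 (?T \<times>\<^sub>o ?T) ?T \<cdot> \<pi>\<^sub>1 ?T ?T, \<pi>\<^sub>1 (?T \<times>\<^sub>o ?T) ?T\<rangle>\<rangle> \<cdot> (\<one> ?T \<times>\<^sub>a tmult) \<cdot> tmult"
    using tmult_assoc[of "\<pi>\<^sub>0 (?T \<times>\<^sub>o ?T) ?T \<cdot> \<pi>\<^sub>0 ?T ?T" "(?T \<times>\<^sub>o ?T) \<times>\<^sub>o ?T"
        "\<pi>\<^sub>0 (?T \<times>\<^sub>o ?T) ?T \<cdot> \<pi>\<^sub>1 ?T ?T" "\<pi>\<^sub>1 (?T \<times>\<^sub>o ?T) ?T"]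
    by (simp add: prd_arr_def flip: cmp_pair)
qed

text \<open>The zero section, the projection and the lift are homomorphisms by their naturality at \<open>m\<close>.\<close>

lemma tmult_zero:
  assumes "a \<in> hom X Y G" "b \<in> hom X Y G"
  shows "\<langle>a \<cdot> \<zero> G, b \<cdot> \<zero> G\<rangle> \<cdot> tmult = \<langle>a, b\<rangle> \<cdot> m \<cdot> \<zero> G"
proof -
  have Y: "Y \<in> obj X"
    using assms(1) src_obj[of a] by simp
  have "\<langle>\<zero> Y \<cdot> \<T> a, \<zero> Y \<cdot> \<T> b\<rangle> \<cdot> tmult = \<zero> Y \<cdot> \<T> (\<langle>a, b\<rangle> \<cdot> m)"
    by (rule tmult_point[OF _ assms]) (use Y in simp)
  then show ?thesis
    using assms zero_nat_arr[of a G] zero_nat_arr[of b G] zero_nat_arr[of "\<langle>a, b\<rangle> \<cdot> m" G] by simp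
qed

lemma tmult_as_tan:
  assumes "h \<in> hom X Y (\<T>\<^sub>o (G \<times>\<^sub>o G))"
  shows "\<langle>h \<cdot> \<T> (\<pi>\<^sub>0 G G), h \<cdot> \<T> (\<pi>\<^sub>1 G G)\<rangle> \<cdot> tmult = h \<cdot> \<T> m"
  using tmult_point[OF assms, of "\<pi>\<^sub>0 G G" "\<pi>\<^sub>1 G G"] by simp

lemma tmult_proj:
  assumes "a \<in> hom X Y (\<T>\<^sub>o G)" "b \<in> hom X Y (\<T>\<^sub>o G)"
  shows "\<langle>a, b\<rangle> \<cdot> tmult \<cdot> \<p> G = \<langle>a \<cdot> \<p> G, b \<cdot> \<p> G\<rangle> \<cdot> m"
proof -
  obtain h where h: "h \<in> hom X Y (\<T>\<^sub>o (G \<times>\<^sub>o G))" "h \<cdot> \<T> (\<pi>\<^sub>0 G G) = a" "h \<cdot> \<T> (\<pi>\<^sub>1 G G) = b"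
    using tan_prd_point[OF assms G_obj G_obj] .
  have "\<langle>a, b\<rangle> \<cdot> tmult \<cdot> \<p> G = (h \<cdot> \<T> m) \<cdot> \<p> G"
    unfolding tmult_as_tan[OF h(1), unfolded h(2,3)] ..
  also have "\<dots> = h \<cdot> \<p> (G \<times>\<^sub>o G) \<cdot> \<langle>\<pi>\<^sub>0 G G, \<pi>\<^sub>1 G G\<rangle> \<cdot> m"
    using h(1) proj_nat_arr[of m G] by simp
  also have "\<dots> = \<langle>(h \<cdot> \<T> (\<pi>\<^sub>0 G G)) \<cdot> \<p> G, (h \<cdot> \<T> (\<pi>\<^sub>1 G G)) \<cdot> \<p> G\<rangle> \<cdot> m"
    using h(1) proj_nat_arr[of "\<pi>\<^sub>0 G G" G] proj_nat_arr[of "\<pi>\<^sub>1 G G" G] by (simp flip: pair_projs)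
  finally show ?thesis
    unfolding h(2,3) .
qed

lemma tmult_lift:
  assumes "a \<in> hom X Y (\<T>\<^sub>o G)" "b \<in> hom X Y (\<T>\<^sub>o G)"
  shows "\<langle>a, b\<rangle> \<cdot> tmult \<cdot> \<ell> G = \<langle>a \<cdot> \<ell> G, b \<cdot> \<ell> G\<rangle> \<cdot> tan_from_prd X (\<T>\<^sub>o G) (\<T>\<^sub>o G) tmult"
proof -
  obtain h where h: "h \<in> hom X Y (\<T>\<^sub>o (G \<times>\<^sub>o G))" "h \<cdot> \<T> (\<pi>\<^sub>0 G G) = a" "h \<cdot> \<T> (\<pi>\<^sub>1 G G) = b"
    using tan_prd_point[OF assms G_obj G_obj] .
  let ?h = "h \<cdot> \<ell> (G \<times>\<^sub>o G)"
  have "\<langle>a, b\<rangle> \<cdot> tmult \<cdot> \<ell> G = (h \<cdot> \<T> m) \<cdot> \<ell> G"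
    unfolding tmult_as_tan[OF h(1), unfolded h(2,3)] ..
  also have "\<dots> = ?h \<cdot> \<T> (\<T> m)"
    using h(1) lift_nat_arr[of m G] by simp
  also have "\<T> m = \<langle>\<T> (\<pi>\<^sub>0 G G), \<T> (\<pi>\<^sub>1 G G)\<rangle> \<cdot> tmult"
    using tmult_as_tan[of "\<one> (\<T>\<^sub>o (G \<times>\<^sub>o G))"] by simp
  also have "?h \<cdot> \<T> \<dots> = \<langle>?h \<cdot> \<T> (\<T> (\<pi>\<^sub>0 G G)), ?h \<cdot> \<T> (\<T> (\<pi>\<^sub>1 G G))\<rangle> \<cdot> tan_from_prd X (\<T>\<^sub>o G) (\<T>\<^sub>o G) tmult"
    by (rule tan_from_prd_point[symmetric]) (use h(1) in simp_all)
  also have "?h \<cdot> \<T> (\<T> (\<pi>\<^sub>0 G G)) = (h \<cdot> \<T> (\<pi>\<^sub>0 G G)) \<cdot> \<ell> G"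
    using h(1) lift_nat_arr[of "\<pi>\<^sub>0 G G" G] by simp
  also have "?h \<cdot> \<T> (\<T> (\<pi>\<^sub>1 G G)) = (h \<cdot> \<T> (\<pi>\<^sub>1 G G)) \<cdot> \<ell> G"
    using h(1) lift_nat_arr[of "\<pi>\<^sub>1 G G" G] by simp
  finally show ?thesis
    unfolding h(2,3) .
qed

end

section \<open>The tangent space at the unit\<close>

locale unit_tangent_space = group_object X G m u \<iota>
  for X :: "('o, 'a, 'm) cartesian_tangent_data_scheme" (structure) and G m u \<iota> +
  fixes K :: 'o and k :: 'a
  assumes fibre: "is_pullback X (\<p> G) u K k (\<tau> K)"
    and tan_fibre: "is_pullback X (\<T> (\<p> G)) (\<T> u) (\<T>\<^sub>o K) (\<T> k) (\<T> (\<tau> K))"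
begin

lemma arr_fibre [simp]: "k \<in> arr X" "src X k = K" "tgt X k = \<T>\<^sub>o G" "K \<in> obj X"
proof -
  show k: "k \<in> arr X" "src X k = K" "tgt X k = \<T>\<^sub>o G"
    using fibre by (simp_all add: is_pullback_def)
  show "K \<in> obj X"
    using src_obj[OF k(1)] k(2) by simp
qed

lemma fibre_proj: "k \<cdot> \<p> G = \<tau> K \<cdot> u"
  using fibre by (simp add: is_pullback_def)

lemma fibre_mono:
  assumes "x \<in> hom X Y K" "y \<in> hom X Y K" "x \<cdot> k = y \<cdot> k"
  shows "x = y"
  by (rule pullback_ext[OF fibre assms])
    (use assms(1,2) in simp)

text \<open>The other leg of the pullback ends in \<open>T(1)\<close>, which is terminal, so \<open>T(p\<^sub>u\<^sup>*)\<close> alone is monic.\<close>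

lemma tan_fibre_mono:
  assumes "x \<in> hom X Y (\<T>\<^sub>o K)" "y \<in> hom X Y (\<T>\<^sub>o K)" "x \<cdot> \<T> k = y \<cdot> \<T> k"
  shows "x = y"
  by (rule pullback_ext[OF tan_fibre assms], rule tan_unit_ext[of _ Y])
    (use assms(1,2) in simp_all)

lemma fibre_lift:
  assumes "h \<in> hom X Y (\<T>\<^sub>o G)" "h \<cdot> \<p> G = \<tau> Y \<cdot> u"
  shows "tan_space_lift X k h \<in> hom X Y K" "tan_space_lift X k h \<cdot> k = h"
proof -
  have Y: "Y \<in> obj X"
    using assms(1) src_obj[of h] by simp
  have "\<tau> Y \<in> hom X Y (src X u)" "h \<in> hom X Y (src X (\<p> G))"
    using Y assms(1) by simp_all
  then obtain g where g: "g \<in> hom X Y K" "g \<cdot> k = h"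
    using fibre[unfolded is_pullback_def] assms(2) by blast
  have "tan_space_lift X k h = g"
    unfolding tan_space_lift_def
    using g assms(1) by (intro the_equality) (auto intro: fibre_mono[of _ Y])
  then show "tan_space_lift X k h \<in> hom X Y K" "tan_space_lift X k h \<cdot> k = h"
    using g by simp_all
qed

abbreviation zero_vec where "zero_vec \<equiv> tan_space_zero X G u k"

lemma bang_unit: "\<tau> \<I> = \<one> \<I>"
  by (rule unit_ext[of _ \<I>]) simp_all

lemma zero_vec [simp]:
  "zero_vec \<in> arr X" "src X zero_vec = \<I>" "tgt X zero_vec = K" "zero_vec \<cdot> k = u \<cdot> \<zero> G"
proof -
  have "(u \<cdot> \<zero> G) \<cdot> \<p> G = \<tau> \<I> \<cdot> u"
    by (simp add: bang_unit)
  from fibre_lift[OF _ this] show "zero_vec \<in> arr X" "src X zero_vec = \<I>" "tgt X zero_vec = K"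
    "zero_vec \<cdot> k = u \<cdot> \<zero> G"
    unfolding tan_space_zero_def by simp_all
qed

abbreviation vlift where "vlift \<equiv> tan_space_vlift X G k"

text \<open>Since \<open>\<ell>T(p) = p0\<close>, the lift of a vector at the unit lies over the zero vector at the unit, which
  comes from \<open>T(1)\<close> along \<open>T(u)\<close>.\<close>

lemma vlift_universal: "vlift \<in> hom X K (\<T>\<^sub>o K) \<and> vlift \<cdot> \<T> k = k \<cdot> \<ell> G"
proof -
  have "(k \<cdot> \<ell> G) \<cdot> \<T> (\<p> G) = (k \<cdot> \<p> G) \<cdot> \<zero> G"
    by (simp add: lift_tan_proj)
  also have "\<dots> = (\<tau> K \<cdot> \<zero> \<I>) \<cdot> \<T> u"
    unfolding fibre_proj using zero_nat_arr[of u G] by simp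
  finally have e: "(k \<cdot> \<ell> G) \<cdot> \<T> (\<p> G) = (\<tau> K \<cdot> \<zero> \<I>) \<cdot> \<T> u" .
  have "k \<cdot> \<ell> G \<in> hom X K (src X (\<T> (\<p> G)))" "\<tau> K \<cdot> \<zero> \<I> \<in> hom X K (src X (\<T> u))"
    by simp_all
  then obtain f where f: "f \<in> hom X K (\<T>\<^sub>o K)" "f \<cdot> \<T> k = k \<cdot> \<ell> G"
    using tan_fibre[unfolded is_pullback_def] e by blast
  have "vlift = f"
    unfolding tan_space_vlift_def Let_def arr_fibre
    using f by (intro the_equality) (auto intro: tan_fibre_mono[of _ K])
  then show ?thesis
    using f by simp
qed

lemma vlift [simp]: "vlift \<in> arr X" "src X vlift = K" "tgt X vlift = \<T>\<^sub>o K" "vlift \<cdot> \<T> k = k \<cdot> \<ell> G"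
  using vlift_universal by simp_all

lemma vlift_proj: "vlift \<cdot> \<p> K = \<tau> K \<cdot> zero_vec"
proof (rule fibre_mono[of _ K])
  have "(vlift \<cdot> \<p> K) \<cdot> k = (vlift \<cdot> \<T> k) \<cdot> \<p> (\<T>\<^sub>o G)"
    using proj_nat_arr[of k "\<T>\<^sub>o G"] by (simp del: vlift(4))
  also have "\<dots> = (k \<cdot> \<p> G) \<cdot> \<zero> G"
    by (simp add: lift_proj)
  also have "\<dots> = (\<tau> K \<cdot> zero_vec) \<cdot> k"
    unfolding fibre_proj by simp
  finally show "(vlift \<cdot> \<p> K) \<cdot> k = (\<tau> K \<cdot> zero_vec) \<cdot> k" .
qed simp_all

abbreviation vadd where "vadd \<equiv> tan_space_add X G k"

lemma vadd_base:
  "(\<pi>\<^sub>0 K K \<cdot> k) \<cdot> \<p> G = (\<pi>\<^sub>1 K K \<cdot> k) \<cdot> \<p> G"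
  by (simp add: fibre_proj)

lemma vadd_universal:
  "vadd \<in> hom X (K \<times>\<^sub>o K) K \<and> vadd \<cdot> k = T2_pair G (\<pi>\<^sub>0 K K \<cdot> k) (\<pi>\<^sub>1 K K \<cdot> k) \<cdot> \<ss> G"
proof -
  let ?a = "\<pi>\<^sub>0 K K \<cdot> k" and ?b = "\<pi>\<^sub>1 K K \<cdot> k"
  have ab: "?a \<in> hom X (K \<times>\<^sub>o K) (\<T>\<^sub>o G)" "?b \<in> hom X (K \<times>\<^sub>o K) (\<T>\<^sub>o G)"
    by simp_all
  note U = T2_pair_universal[OF G_obj ab vadd_base]
  have "(T2_pair G ?a ?b \<cdot> \<ss> G) \<cdot> \<p> G = (T2_pair G ?a ?b \<cdot> \<rho>\<^sub>0 G) \<cdot> \<p> G"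
    using U(1) by (simp add: add_proj)
  also have "\<dots> = \<tau> (K \<times>\<^sub>o K) \<cdot> u"
    unfolding U(2) by (simp add: fibre_proj)
  finally have e: "(T2_pair G ?a ?b \<cdot> \<ss> G) \<cdot> \<p> G = \<tau> (K \<times>\<^sub>o K) \<cdot> u" .
  have "T2_pair G ?a ?b \<cdot> \<ss> G \<in> hom X (K \<times>\<^sub>o K) (\<T>\<^sub>o G)"
    using U(1) by simp
  from fibre_lift[OF this e] show ?thesis
    unfolding tan_space_add_def Let_def arr_fibre by blast
qed

lemma arr_vadd [simp]: "vadd \<in> arr X" "src X vadd = K \<times>\<^sub>o K" "tgt X vadd = K"
  using vadd_universal by simp_all

text \<open>The addition \<open>T(+\<^sub>u)\<close> of \<open>T(T(G)\<^sub>u)\<close> is inherited from \<open>T(+)\<close> on \<open>T\<^sup>2(G)\<close>.\<close>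

lemma tan_vadd:
  assumes "x \<in> hom X Y (\<T>\<^sub>o K)" "y \<in> hom X Y (\<T>\<^sub>o K)"
  shows "(\<langle>x, y\<rangle> \<cdot> tan_from_prd X K K vadd) \<cdot> \<T> k = tan_T2_pair G (x \<cdot> \<T> k) (y \<cdot> \<T> k) \<cdot> \<T> (\<ss> G)"
proof -
  let ?a = "\<pi>\<^sub>0 K K \<cdot> k" and ?b = "\<pi>\<^sub>1 K K \<cdot> k"
  obtain h where h: "h \<in> hom X Y (\<T>\<^sub>o (K \<times>\<^sub>o K))" "h \<cdot> \<T> (\<pi>\<^sub>0 K K) = x" "h \<cdot> \<T> (\<pi>\<^sub>1 K K) = y"
    using tan_prd_point[OF assms arr_fibre(4) arr_fibre(4)] .
  have ab: "?a \<in> hom X (K \<times>\<^sub>o K) (\<T>\<^sub>o G)" "?b \<in> hom X (K \<times>\<^sub>o K) (\<T>\<^sub>o G)"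
    by simp_all
  note U = T2_pair_universal[OF G_obj ab vadd_base]
  have "\<langle>x, y\<rangle> \<cdot> tan_from_prd X K K vadd = h \<cdot> \<T> vadd"
    using tan_from_prd_point[OF h(1), of "\<pi>\<^sub>0 K K" K "\<pi>\<^sub>1 K K" K vadd K] unfolding h(2,3) by simp
  then have "(\<langle>x, y\<rangle> \<cdot> tan_from_prd X K K vadd) \<cdot> \<T> k = (h \<cdot> \<T> vadd) \<cdot> \<T> k"
    by (rule arg_cong)
  also have "\<dots> = h \<cdot> \<T> (vadd \<cdot> k)"
    using h(1) by simp
  also have "\<dots> = (h \<cdot> \<T> (T2_pair G ?a ?b)) \<cdot> \<T> (\<ss> G)"
    unfolding conjunct2[OF vadd_universal] using h(1) U(1) by simp
  also have "h \<cdot> \<T> (T2_pair G ?a ?b) = tan_T2_pair G (x \<cdot> \<T> k) (y \<cdot> \<T> k)"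
  proof -
    have "h \<cdot> \<T> (?a \<cdot> \<p> G) = h \<cdot> \<T> (?b \<cdot> \<p> G)"
      by (simp only: vadd_base)
    then have e: "(x \<cdot> \<T> k) \<cdot> \<T> (\<p> G) = (y \<cdot> \<T> k) \<cdot> \<T> (\<p> G)"
      unfolding h(2,3)[symmetric] using h(1) by simp
    have xy: "x \<cdot> \<T> k \<in> hom X Y (\<T>\<^sub>o (\<T>\<^sub>o G))" "y \<cdot> \<T> k \<in> hom X Y (\<T>\<^sub>o (\<T>\<^sub>o G))"
      using assms by simp_all
    note U' = tan_T2_pair_universal[OF G_obj xy e]
    show ?thesis
    proof (rule tan_T2_ext[OF G_obj _ U'(1)])
      show "h \<cdot> \<T> (T2_pair G ?a ?b) \<in> hom X Y (\<T>\<^sub>o (T2 X G))"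
        using h(1) U(1) by simp
      have "(h \<cdot> \<T> (T2_pair G ?a ?b)) \<cdot> \<T> (\<rho>\<^sub>0 G) = h \<cdot> \<T> (T2_pair G ?a ?b \<cdot> \<rho>\<^sub>0 G)"
        using h(1) U(1) by simp
      also have "\<dots> = x \<cdot> \<T> k"
        unfolding U(2) h(2)[symmetric] using h(1) by simp
      finally show "(h \<cdot> \<T> (T2_pair G ?a ?b)) \<cdot> \<T> (\<rho>\<^sub>0 G) = tan_T2_pair G (x \<cdot> \<T> k) (y \<cdot> \<T> k) \<cdot> \<T> (\<rho>\<^sub>0 G)"
        unfolding U'(2) .
      have "(h \<cdot> \<T> (T2_pair G ?a ?b)) \<cdot> \<T> (\<rho>\<^sub>1 G) = h \<cdot> \<T> (T2_pair G ?a ?b \<cdot> \<rho>\<^sub>1 G)"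
        using h(1) U(1) by simp
      also have "\<dots> = y \<cdot> \<T> k"
        unfolding U(3) h(3)[symmetric] using h(1) by simp
      finally show "(h \<cdot> \<T> (T2_pair G ?a ?b)) \<cdot> \<T> (\<rho>\<^sub>1 G) = tan_T2_pair G (x \<cdot> \<T> k) (y \<cdot> \<T> k) \<cdot> \<T> (\<rho>\<^sub>1 G)"
        unfolding U'(3) .
    qed
  qed
  finally show ?thesis .
qed

text \<open>The splitting \<open>h = w\<ell>\<^sub>u + hp0\<close> that defines \<open>w = h{1}\<close>.\<close>

abbreviation splits where
  "splits h w \<equiv> h = \<langle>w \<cdot> vlift, h \<cdot> \<p> K \<cdot> \<zero> K\<rangle> \<cdot> tan_from_prd X K K vadd"

lemma tan_fibre_base:
  assumes "h \<in> hom X Y (\<T>\<^sub>o K)" "w \<in> hom X Y K"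
  shows "w \<cdot> k \<in> hom X Y (\<T>\<^sub>o G)" "h \<cdot> \<p> K \<cdot> k \<in> hom X Y (\<T>\<^sub>o G)"
    "(w \<cdot> k) \<cdot> \<p> G = (h \<cdot> \<p> K \<cdot> k) \<cdot> \<p> G"
  using assms by (simp_all add: fibre_proj)

text \<open>Comparing after the monic \<open>T(p\<^sub>u\<^sup>*)\<close> reduces splittings in \<open>T(T(G)\<^sub>u)\<close> to the universal lift on \<open>G\<close>.\<close>

lemma splits_iff:
  assumes "h \<in> hom X Y (\<T>\<^sub>o K)" "w \<in> hom X Y K"
  shows "splits h w \<longleftrightarrow> h \<cdot> \<T> k = pair_lift G (w \<cdot> k) (h \<cdot> \<p> K \<cdot> k)"
proof -
  let ?s = "\<langle>w \<cdot> vlift, h \<cdot> \<p> K \<cdot> \<zero> K\<rangle> \<cdot> tan_from_prd X K K vadd"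
  have s: "?s \<in> hom X Y (\<T>\<^sub>o K)"
    using assms by simp
  have t: "w \<cdot> vlift \<in> hom X Y (\<T>\<^sub>o K)" "h \<cdot> \<p> K \<cdot> \<zero> K \<in> hom X Y (\<T>\<^sub>o K)"
    using assms by simp_all
  have "(w \<cdot> vlift) \<cdot> \<T> k = (w \<cdot> k) \<cdot> \<ell> G"
    using assms(2) by simp
  moreover have "(h \<cdot> \<p> K \<cdot> \<zero> K) \<cdot> \<T> k = (h \<cdot> \<p> K \<cdot> k) \<cdot> \<zero> (\<T>\<^sub>o G)"
    using assms(1) zero_nat_arr[of k "\<T>\<^sub>o G"] by simp
  ultimately have "?s \<cdot> \<T> k = pair_lift G (w \<cdot> k) (h \<cdot> \<p> K \<cdot> k)"
    unfolding tan_vadd[OF t] by simp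
  then show ?thesis
    using tan_fibre_mono[OF assms(1) s] by metis
qed

lemma splits_unique:
  assumes "h \<in> hom X Y (\<T>\<^sub>o K)" "w \<in> hom X Y K" "w' \<in> hom X Y K" "splits h w" "splits h w'"
  shows "w = w'"
proof -
  note B = tan_fibre_base[OF assms(1,2)] and B' = tan_fibre_base[OF assms(1,3)]
  have "pair_lift G (w \<cdot> k) (h \<cdot> \<p> K \<cdot> k) = pair_lift G (w' \<cdot> k) (h \<cdot> \<p> K \<cdot> k)"
    using splits_iff[OF assms(1,2), THEN iffD1, OF assms(4)]
      splits_iff[OF assms(1,3), THEN iffD1, OF assms(5)] by simp
  then show ?thesis
    by (intro fibre_mono[OF assms(2,3)] pair_lift_inj[OF G_obj B(1) B'(1) B(2) B(3) B'(3)])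
qed

text \<open>The base \<open>hT(p\<^sub>u\<^sup>*)T(p)\<close> factors through \<open>T(1)\<close>, so it is the zero vector at the unit. This is what
  the equalizer condition on \<open>hT(p\<^sub>u\<^sup>*)\<close> requires.\<close>

lemma splits_exists:
  assumes "h \<in> hom X Y (\<T>\<^sub>o K)"
  obtains w where "w \<in> hom X Y K" "splits h w"
proof -
  let ?h = "h \<cdot> \<T> k"
  have Y: "Y \<in> obj X"
    using assms src_obj[of h] by simp
  have hom: "?h \<in> hom X Y (\<T>\<^sub>o (\<T>\<^sub>o G))"
    using assms by simp
  have "?h \<cdot> \<T> (\<p> G) = h \<cdot> \<T> (k \<cdot> \<p> G)"
    using assms by simp
  then have hp: "?h \<cdot> \<T> (\<p> G) = \<tau> Y \<cdot> u \<cdot> \<zero> G"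
    unfolding fibre_proj tan_unit_point[OF assms arr_fibre(4)] .
  have "?h \<cdot> (\<T> (\<p> G) \<cdot> \<p> G \<cdot> \<zero> G) = (?h \<cdot> \<T> (\<p> G)) \<cdot> \<p> G \<cdot> \<zero> G"
    using assms by simp
  also have "\<dots> = ?h \<cdot> \<T> (\<p> G)"
    unfolding hp using Y by simp
  finally obtain a where a: "a \<in> hom X Y (\<T>\<^sub>o G)" "a \<cdot> \<p> G = ?h \<cdot> \<p> (\<T>\<^sub>o G) \<cdot> \<p> G"
    "?h = pair_lift G a (?h \<cdot> \<p> (\<T>\<^sub>o G))"
    using pair_lift_surj[OF G_obj hom] by metis
  have hpk: "?h \<cdot> \<p> (\<T>\<^sub>o G) = h \<cdot> \<p> K \<cdot> k"
    using assms proj_nat_arr[of k "\<T>\<^sub>o G"] by simp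
  have "a \<cdot> \<p> G = \<tau> Y \<cdot> u"
    unfolding a(2) hpk using assms by (simp add: fibre_proj)
  note w = fibre_lift[OF a(1) this]
  show ?thesis
  proof (rule that[OF w(1)])
    show "splits h (tan_space_lift X k a)"
      unfolding splits_iff[OF assms w(1)] w(2) using a(3) unfolding hpk .
  qed
qed

abbreviation vert where "vert \<equiv> tan_space_vert X G k"

lemma vert_universal:
  "vert \<in> hom X (\<T>\<^sub>o K) K \<and> \<one> (\<T>\<^sub>o K) = \<langle>vert \<cdot> vlift, \<p> K \<cdot> \<zero> K\<rangle> \<cdot> tan_from_prd X K K vadd"
proof -
  have i: "\<one> (\<T>\<^sub>o K) \<in> hom X (\<T>\<^sub>o K) (\<T>\<^sub>o K)" "\<one> (\<T>\<^sub>o K) \<cdot> \<p> K \<cdot> \<zero> K = \<p> K \<cdot> \<zero> K"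
    by simp_all
  obtain w where w: "w \<in> hom X (\<T>\<^sub>o K) K" "splits (\<one> (\<T>\<^sub>o K)) w"
    using splits_exists[OF i(1)] .
  have "vert = w"
    unfolding tan_space_vert_def Let_def arr_fibre
  proof (rule the_equality)
    show "w \<in> hom X (\<T>\<^sub>o K) K \<and>
        \<one> (\<T>\<^sub>o K) = \<langle>w \<cdot> vlift, \<p> K \<cdot> \<zero> K\<rangle> \<cdot> tan_from_prd X K K vadd"
      using w unfolding i(2) ..
    show "f = w" if "f \<in> hom X (\<T>\<^sub>o K) K \<and>
        \<one> (\<T>\<^sub>o K) = \<langle>f \<cdot> vlift, \<p> K \<cdot> \<zero> K\<rangle> \<cdot> tan_from_prd X K K vadd" for f
      using splits_unique[OF i(1) _ w(1) _ w(2)] that unfolding i(2) by blast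
  qed
  then show ?thesis
    using w unfolding i(2) by blast
qed

lemma arr_vert [simp]: "vert \<in> arr X" "src X vert = \<T>\<^sub>o K" "tgt X vert = K"
  using vert_universal by simp_all

text \<open>The lift \<open>\<ell>\<^sub>u\<close> splits with first part \<open>\<ell>\<^sub>u{1}\<close> by the definition of \<open>{1}\<close>, and with first part \<open>1\<close>
  since its base point is zero. Splittings are unique.\<close>

lemma vlift_vert: "vlift \<cdot> vert = \<one> K"
proof (rule splits_unique[of vlift K])
  show "vlift \<in> hom X K (\<T>\<^sub>o K)" "vlift \<cdot> vert \<in> hom X K K" "\<one> K \<in> hom X K K"
    by simp_all
  have "vlift = vlift \<cdot> \<one> (\<T>\<^sub>o K)"
    by simp
  also have "\<dots> = vlift \<cdot> (\<langle>vert \<cdot> vlift, \<p> K \<cdot> \<zero> K\<rangle> \<cdot> tan_from_prd X K K vadd)"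
    using vert_universal by simp
  also have "\<dots> = \<langle>(vlift \<cdot> vert) \<cdot> vlift, vlift \<cdot> \<p> K \<cdot> \<zero> K\<rangle> \<cdot> tan_from_prd X K K vadd"
    by simp
  finally show "splits vlift (vlift \<cdot> vert)" .
  have "vlift \<cdot> \<p> K \<cdot> k = k \<cdot> \<p> G \<cdot> \<zero> G"
    unfolding vlift_proj fibre_proj by simp
  then have "vlift \<cdot> \<T> k = pair_lift G k (vlift \<cdot> \<p> K \<cdot> k)"
    using pair_lift_zero[OF G_obj, of k K] by simp
  moreover have "\<one> K \<cdot> k = k"
    by simp
  ultimately show "splits vlift (\<one> K)"
    by (subst splits_iff[of _ K]) (simp_all only: vlift arr_fibre arr_idn hom_iff simp_thms)
qed

section \<open>The trivialization\<close>

text \<open>The translation \<open>a \<mapsto> 0(ap)\<^sup>-\<^sup>1 a\<close> of a tangent vector to the unit. Its factorization through the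
  tangent space at the unit, \<open>shear\<close>, is the second component of \<open>\<phi>\<close>.\<close>

abbreviation to_unit where
  "to_unit \<equiv> \<langle>\<p> G \<cdot> \<iota> \<cdot> \<zero> G, \<one> (\<T>\<^sub>o G)\<rangle> \<cdot> tmult"

definition shear where
  "shear = tan_space_lift X k to_unit"

lemma to_unit_hom: "to_unit \<in> hom X (\<T>\<^sub>o G) (\<T>\<^sub>o G)"
  by simp

lemma shear_universal: "shear \<in> hom X (\<T>\<^sub>o G) K" "shear \<cdot> k = to_unit"
proof -
  have "to_unit \<cdot> \<p> G = \<langle>(\<p> G \<cdot> \<iota> \<cdot> \<zero> G) \<cdot> \<p> G, \<one> (\<T>\<^sub>o G) \<cdot> \<p> G\<rangle> \<cdot> m"
    by (rule tmult_proj[of _ "\<T>\<^sub>o G"]) simp_all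
  also have "\<dots> = \<tau> (\<T>\<^sub>o G) \<cdot> u"
    using mult_point_inv(1)[of "\<p> G" "\<T>\<^sub>o G"] by simp
  finally show "shear \<in> hom X (\<T>\<^sub>o G) K" "shear \<cdot> k = to_unit"
    using fibre_lift[OF to_unit_hom] unfolding shear_def by blast+
qed

lemma arr_shear [simp]: "shear \<in> arr X" "src X shear = \<T>\<^sub>o G" "tgt X shear = K"
  using shear_universal(1) by simp_all

lemma shear_point:
  assumes "a \<in> hom X Y (\<T>\<^sub>o G)"
  shows "(a \<cdot> shear) \<cdot> k = \<langle>(a \<cdot> \<p> G \<cdot> \<iota>) \<cdot> \<zero> G, a\<rangle> \<cdot> tmult"
proof -
  have "(a \<cdot> shear) \<cdot> k = a \<cdot> (shear \<cdot> k)"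
    using assms by simp
  then have "(a \<cdot> shear) \<cdot> k = a \<cdot> to_unit"
    unfolding shear_universal(2) .
  then show ?thesis
    using assms by simp
qed

abbreviation \<phi> where "\<phi> \<equiv> trivialization X G m \<iota> k"

lemma triv_eq: "\<phi> = \<langle>\<p> G, shear\<rangle>"
  unfolding trivialization_def shear_def ..

abbreviation \<psi> where "\<psi> \<equiv> (\<zero> G \<times>\<^sub>a k) \<cdot> tmult"

lemma psi_eq: "\<psi> = \<langle>\<pi>\<^sub>0 G K \<cdot> \<zero> G, \<pi>\<^sub>1 G K \<cdot> k\<rangle> \<cdot> tmult"
  by (simp add: prd_arr_def)

lemma psi_hom: "\<psi> \<in> hom X (G \<times>\<^sub>o K) (\<T>\<^sub>o G)"
  unfolding psi_eq by simp

lemma psi_proj: "\<psi> \<cdot> \<p> G = \<pi>\<^sub>0 G K"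
proof -
  have "\<psi> \<cdot> \<p> G = \<langle>(\<pi>\<^sub>0 G K \<cdot> \<zero> G) \<cdot> \<p> G, (\<pi>\<^sub>1 G K \<cdot> k) \<cdot> \<p> G\<rangle> \<cdot> m"
    unfolding psi_eq by (rule tmult_proj[of _ "G \<times>\<^sub>o K"]) simp_all
  also have "\<dots> = \<pi>\<^sub>0 G K"
    using mult_point_unit(2)[of "\<pi>\<^sub>0 G K" "G \<times>\<^sub>o K"] by (simp add: fibre_proj)
  finally show ?thesis .
qed

text \<open>Associativity in \<open>T(G)\<close> gives \<open>0(g)\<^sup>-\<^sup>1 (0(g)v) = (0(g)\<^sup>-\<^sup>1 0(g))v = v\<close>.\<close>

lemma psi_shear: "\<psi> \<cdot> shear = \<pi>\<^sub>1 G K"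
proof (rule fibre_mono[of _ "G \<times>\<^sub>o K"])
  let ?g = "\<pi>\<^sub>0 G K" and ?v = "\<pi>\<^sub>1 G K \<cdot> k"
  have t: "(?g \<cdot> \<iota>) \<cdot> \<zero> G \<in> hom X (G \<times>\<^sub>o K) (\<T>\<^sub>o G)" "?g \<cdot> \<zero> G \<in> hom X (G \<times>\<^sub>o K) (\<T>\<^sub>o G)"
    "?v \<in> hom X (G \<times>\<^sub>o K) (\<T>\<^sub>o G)" "?g \<cdot> \<iota> \<in> hom X (G \<times>\<^sub>o K) G" "?g \<in> hom X (G \<times>\<^sub>o K) G"
    by simp_all
  have "\<psi> \<cdot> \<p> G \<cdot> \<iota> = ?g \<cdot> \<iota>"
    unfolding psi_proj ..
  then have "(\<psi> \<cdot> shear) \<cdot> k = \<langle>(?g \<cdot> \<iota>) \<cdot> \<zero> G, \<psi>\<rangle> \<cdot> tmult"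
    unfolding shear_point[OF psi_hom] by (rule arg_cong)
  also have "\<dots> = \<langle>\<langle>(?g \<cdot> \<iota>) \<cdot> \<zero> G, ?g \<cdot> \<zero> G\<rangle> \<cdot> tmult, ?v\<rangle> \<cdot> tmult"
    unfolding psi_eq tmult_assoc[OF t(1,2,3)] ..
  also have "\<dots> = ?v"
    unfolding tmult_zero[OF t(4,5)] mult_point_inv(1)[OF t(5)] tmult_unit(1)[OF t(3)] ..
  finally show "(\<psi> \<cdot> shear) \<cdot> k = \<pi>\<^sub>1 G K \<cdot> k" .
qed (use psi_hom in simp_all)

lemma triv_inverse: "inverse_arrows X \<phi> \<psi>"
proof -
  have "\<psi> \<cdot> \<phi> = \<langle>\<psi> \<cdot> \<p> G, \<psi> \<cdot> shear\<rangle>"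
    unfolding triv_eq using psi_hom by simp
  then have 1: "\<psi> \<cdot> \<phi> = \<one> (G \<times>\<^sub>o K)"
    unfolding psi_proj psi_shear by simp
  have t: "\<p> G \<cdot> \<zero> G \<in> hom X (\<T>\<^sub>o G) (\<T>\<^sub>o G)" "(\<p> G \<cdot> \<iota>) \<cdot> \<zero> G \<in> hom X (\<T>\<^sub>o G) (\<T>\<^sub>o G)"
    "\<one> (\<T>\<^sub>o G) \<in> hom X (\<T>\<^sub>o G) (\<T>\<^sub>o G)" "\<p> G \<in> hom X (\<T>\<^sub>o G) G" "\<p> G \<cdot> \<iota> \<in> hom X (\<T>\<^sub>o G) G"
    by simp_all
  have "\<phi> \<cdot> \<psi> = \<langle>\<p> G \<cdot> \<zero> G, shear \<cdot> k\<rangle> \<cdot> tmult"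
    unfolding psi_eq triv_eq by simp
  also have "\<dots> = \<langle>\<langle>\<p> G \<cdot> \<zero> G, (\<p> G \<cdot> \<iota>) \<cdot> \<zero> G\<rangle> \<cdot> tmult, \<one> (\<T>\<^sub>o G)\<rangle> \<cdot> tmult"
    unfolding shear_universal(2) tmult_assoc[OF t(1,2,3)] ..
  also have "\<dots> = \<one> (\<T>\<^sub>o G)"
    unfolding tmult_zero[OF t(4,5)] mult_point_inv(2)[OF t(4)] tmult_unit(1)[OF t(3)] ..
  finally have 2: "\<phi> \<cdot> \<psi> = \<one> (\<T>\<^sub>o G)" .
  have "\<phi> \<in> hom X (\<T>\<^sub>o G) (G \<times>\<^sub>o K)"
    unfolding triv_eq by simp
  then show ?thesis
    unfolding inverse_arrows_def using psi_hom 1 2 by simp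
qed

text \<open>In the group \<open>T\<^sup>2(G)\<close>, the lift of \<open>0(g)v\<close> is \<open>00(g)\<close> times the lift of \<open>v\<close>, and translating back
  to the unit removes the first factor.\<close>

lemma psi_lift_shear: "(\<psi> \<cdot> \<ell> G) \<cdot> \<T> shear = \<pi>\<^sub>1 G K \<cdot> vlift"
proof (rule tan_fibre_mono[of _ "G \<times>\<^sub>o K"])
  interpret TG: group_object X "\<T>\<^sub>o G" tmult "u \<cdot> \<zero> G" "\<T> \<iota>"
    by (rule tangent_group)
  let ?Y = "G \<times>\<^sub>o K" and ?g = "\<pi>\<^sub>0 G K" and ?v = "(\<pi>\<^sub>1 G K \<cdot> k) \<cdot> \<ell> G"
  let ?h = "\<psi> \<cdot> \<ell> G"
  have h: "?h \<in> hom X ?Y (\<T>\<^sub>o (\<T>\<^sub>o G))"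
    using psi_hom by simp
  have t: "?g \<cdot> \<zero> G \<in> hom X ?Y (\<T>\<^sub>o G)" "\<pi>\<^sub>1 G K \<cdot> k \<in> hom X ?Y (\<T>\<^sub>o G)"
    "((?g \<cdot> \<iota>) \<cdot> \<zero> G) \<cdot> \<zero> (\<T>\<^sub>o G) \<in> hom X ?Y (\<T>\<^sub>o (\<T>\<^sub>o G))"
    "(?g \<cdot> \<zero> G) \<cdot> \<zero> (\<T>\<^sub>o G) \<in> hom X ?Y (\<T>\<^sub>o (\<T>\<^sub>o G))" "?v \<in> hom X ?Y (\<T>\<^sub>o (\<T>\<^sub>o G))"
    "?g \<cdot> \<iota> \<in> hom X ?Y G" "?g \<in> hom X ?Y G" "(?g \<cdot> \<iota>) \<cdot> \<zero> G \<in> hom X ?Y (\<T>\<^sub>o G)"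
    by simp_all
  have "?h = \<langle>(?g \<cdot> \<zero> G) \<cdot> \<ell> G, ?v\<rangle> \<cdot> TG.tmult"
    unfolding psi_eq by (rule tmult_lift[OF t(1,2)])
  also have "(?g \<cdot> \<zero> G) \<cdot> \<ell> G = (?g \<cdot> \<zero> G) \<cdot> \<zero> (\<T>\<^sub>o G)"
    using zero_lift[OF G_obj] zero_nat_arr[of "\<zero> G" "\<T>\<^sub>o G"] by simp
  finally have lift: "?h = \<langle>(?g \<cdot> \<zero> G) \<cdot> \<zero> (\<T>\<^sub>o G), ?v\<rangle> \<cdot> TG.tmult" .
  have "?h \<cdot> \<T> (\<p> G \<cdot> \<iota> \<cdot> \<zero> G) = (\<psi> \<cdot> \<p> G) \<cdot> \<zero> G \<cdot> \<T> \<iota> \<cdot> \<T> (\<zero> G)"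
  proof -
    have "?h \<cdot> \<T> (\<p> G \<cdot> \<iota> \<cdot> \<zero> G) = \<psi> \<cdot> (\<ell> G \<cdot> \<T> (\<p> G)) \<cdot> \<T> \<iota> \<cdot> \<T> (\<zero> G)"
      using psi_hom by simp
    then show ?thesis
      unfolding lift_tan_proj[OF G_obj] using psi_hom by simp
  qed
  also have "\<dots> = ((?g \<cdot> \<iota>) \<cdot> \<zero> G) \<cdot> \<zero> (\<T>\<^sub>o G)"
    unfolding psi_proj
    using zero_nat_arr[of "\<zero> G" "\<T>\<^sub>o G"] zero_nat_ext[of \<iota> G "\<T> (\<zero> G)"] by simp
  finally have base: "?h \<cdot> \<T> (\<p> G \<cdot> \<iota> \<cdot> \<zero> G) = ((?g \<cdot> \<iota>) \<cdot> \<zero> G) \<cdot> \<zero> (\<T>\<^sub>o G)" .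
  have "(?h \<cdot> \<T> shear) \<cdot> \<T> k = ?h \<cdot> \<T> (shear \<cdot> k)"
    using h by simp
  also have "\<dots> = \<langle>?h \<cdot> \<T> (\<p> G \<cdot> \<iota> \<cdot> \<zero> G), ?h \<cdot> \<T> (\<one> (\<T>\<^sub>o G))\<rangle> \<cdot> TG.tmult"
    unfolding shear_universal(2) by (rule TG.tmult_point[OF h, symmetric]) simp_all
  also have "?h \<cdot> \<T> (\<one> (\<T>\<^sub>o G)) = \<langle>(?g \<cdot> \<zero> G) \<cdot> \<zero> (\<T>\<^sub>o G), ?v\<rangle> \<cdot> TG.tmult"
    unfolding lift[symmetric] using h by simp
  also have "\<langle>?h \<cdot> \<T> (\<p> G \<cdot> \<iota> \<cdot> \<zero> G), \<dots>\<rangle> \<cdot> TG.tmult =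
      \<langle>\<langle>((?g \<cdot> \<iota>) \<cdot> \<zero> G) \<cdot> \<zero> (\<T>\<^sub>o G), (?g \<cdot> \<zero> G) \<cdot> \<zero> (\<T>\<^sub>o G)\<rangle> \<cdot> TG.tmult, ?v\<rangle> \<cdot> TG.tmult"
    unfolding base TG.tmult_assoc[OF t(3,4,5)] ..
  also have "\<dots> = \<langle>\<tau> ?Y \<cdot> (u \<cdot> \<zero> G) \<cdot> \<zero> (\<T>\<^sub>o G), ?v\<rangle> \<cdot> TG.tmult"
  proof -
    have "\<tau> ?Y \<cdot> u \<cdot> \<zero> G = \<tau> ?Y \<cdot> (u \<cdot> \<zero> G)"
      by simp
    then show ?thesis
      unfolding TG.tmult_zero[OF t(8,1)] tmult_zero[OF t(6,7)] mult_point_inv(1)[OF t(7)] by simp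
  qed
  also have "\<dots> = (\<pi>\<^sub>1 G K \<cdot> vlift) \<cdot> \<T> k"
    unfolding TG.tmult_unit(1)[OF t(5)] by simp
  finally show "(?h \<cdot> \<T> shear) \<cdot> \<T> k = (\<pi>\<^sub>1 G K \<cdot> vlift) \<cdot> \<T> k" .
qed (use psi_hom in simp_all)

lemma zero_shear: "\<zero> G \<cdot> shear = \<tau> G \<cdot> zero_vec"
proof (rule fibre_mono[of _ G])
  have "(\<zero> G \<cdot> shear) \<cdot> k = \<langle>(\<zero> G \<cdot> \<p> G \<cdot> \<iota>) \<cdot> \<zero> G, \<zero> G\<rangle> \<cdot> tmult"
    by (rule shear_point[of _ G]) simp
  also have "\<dots> = \<langle>\<iota> \<cdot> \<zero> G, \<one> G \<cdot> \<zero> G\<rangle> \<cdot> tmult"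
    by simp
  also have "\<dots> = (\<tau> G \<cdot> u) \<cdot> \<zero> G"
    by (subst tmult_zero[of _ G]) (simp_all only: mult_inv_left, simp_all)
  also have "\<dots> = (\<tau> G \<cdot> zero_vec) \<cdot> k"
    by simp
  finally show "(\<zero> G \<cdot> shear) \<cdot> k = (\<tau> G \<cdot> zero_vec) \<cdot> k" .
qed simp_all

text \<open>The four components are \<open>0p = 1\<close>, the translate \<open>0(g)\<^sup>-\<^sup>1 0(g)\<close> of a zero vector, the base point of
  \<open>\<ell>\<^sub>u\<close>, and \<open>\<ell>\<^sub>u{1} = 1\<close>.\<close>

lemma lift_in_trivialization:
  "\<psi> \<cdot> \<ell> G \<cdot> tan_to_prd X G K \<phi> \<cdot> (\<phi> \<times>\<^sub>a \<langle>\<p> K, vert\<rangle>) =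
    \<langle>\<langle>\<pi>\<^sub>0 G K, \<tau> (G \<times>\<^sub>o K) \<cdot> zero_vec\<rangle>, \<langle>\<tau> (G \<times>\<^sub>o K) \<cdot> zero_vec, \<pi>\<^sub>1 G K\<rangle>\<rangle>"
proof -
  let ?h = "\<psi> \<cdot> \<ell> G" and ?Y = "G \<times>\<^sub>o K"
  have h: "?h \<in> arr X" "src X ?h = ?Y" "tgt X ?h = \<T>\<^sub>o (\<T>\<^sub>o G)"
    using psi_hom by simp_all
  have to: "tan_to_prd X G K \<phi> = \<langle>\<T> (\<p> G), \<T> shear\<rangle>"
    by (simp add: tan_to_prd_def triv_eq tan_split_def flip: tan_cmp_arr)
  have "?h \<cdot> \<T> (\<p> G) = \<psi> \<cdot> (\<ell> G \<cdot> \<T> (\<p> G))"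
    using psi_hom by simp
  also have "\<dots> = (\<psi> \<cdot> \<p> G) \<cdot> \<zero> G"
    unfolding lift_tan_proj[OF G_obj] using psi_hom by simp
  finally have base: "?h \<cdot> \<T> (\<p> G) = \<pi>\<^sub>0 G K \<cdot> \<zero> G"
    unfolding psi_proj .
  have "?h \<cdot> tan_to_prd X G K \<phi> = \<langle>?h \<cdot> \<T> (\<p> G), ?h \<cdot> \<T> shear\<rangle>"
    unfolding to by (rule cmp_pair) (simp_all add: h)
  also have "\<dots> = \<langle>\<pi>\<^sub>0 G K \<cdot> \<zero> G, \<pi>\<^sub>1 G K \<cdot> vlift\<rangle>"
    unfolding base psi_lift_shear ..
  finally have "?h \<cdot> tan_to_prd X G K \<phi> \<cdot> (\<phi> \<times>\<^sub>a \<langle>\<p> K, vert\<rangle>) =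
      \<langle>\<pi>\<^sub>0 G K \<cdot> \<zero> G, \<pi>\<^sub>1 G K \<cdot> vlift\<rangle> \<cdot> (\<phi> \<times>\<^sub>a \<langle>\<p> K, vert\<rangle>)"
    by (rule arg_cong)
  also have "\<dots> = \<langle>\<langle>\<pi>\<^sub>0 G K, \<pi>\<^sub>0 G K \<cdot> (\<zero> G \<cdot> shear)\<rangle>, \<langle>\<pi>\<^sub>1 G K \<cdot> (vlift \<cdot> \<p> K), \<pi>\<^sub>1 G K \<cdot> (vlift \<cdot> vert)\<rangle>\<rangle>"
    by (simp add: prd_arr_def triv_eq)
  also have "\<dots> = \<langle>\<langle>\<pi>\<^sub>0 G K, \<tau> ?Y \<cdot> zero_vec\<rangle>, \<langle>\<tau> ?Y \<cdot> zero_vec, \<pi>\<^sub>1 G K\<rangle>\<rangle>"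
    unfolding zero_shear vlift_proj vlift_vert by simp
  finally show ?thesis .
qed

end

theorem proposition6:
  fixes X :: "('o, 'a) cartesian_tangent_data" (structure)
    and G K :: 'o and m u \<iota> k :: 'a
  assumes "group_object X G m u \<iota>"
    and "is_pullback X (\<p> G) u K k (\<tau> K)"
    and "is_pullback X (\<T> (\<p> G)) (\<T> u) (\<T>\<^sub>o K) (\<T> k) (\<T> (\<tau> K))"
  shows "let \<phi> = trivialization X G m \<iota> k; z = tan_space_zero X G u k in
    \<phi> \<in> hom X (\<T>\<^sub>o G) (G \<times>\<^sub>o K)
    \<and> inverse_arrows X \<phi> ((\<zero> G \<times>\<^sub>a k) \<cdot> tan_from_prd X G G m)
    \<and> inv_arr X \<phi> \<cdot> \<ell> G \<cdot> tan_to_prd X G K \<phi> \<cdot> (\<phi> \<times>\<^sub>a \<langle>\<p> K, tan_space_vert X G k\<rangle>)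
        = \<langle>\<langle>\<pi>\<^sub>0 G K, \<tau> (G \<times>\<^sub>o K) \<cdot> z\<rangle>, \<langle>\<tau> (G \<times>\<^sub>o K) \<cdot> z, \<pi>\<^sub>1 G K\<rangle>\<rangle>"
proof -
  interpret unit_tangent_space X G m u \<iota> K k
    using assms by (simp add: unit_tangent_space_def unit_tangent_space_axioms_def)
  have "trivialization X G m \<iota> k \<in> hom X (\<T>\<^sub>o G) (G \<times>\<^sub>o K)"
    unfolding triv_eq by simp
  then show ?thesis
    unfolding Let_def inv_arr_eq[OF triv_inverse]
    using triv_inverse lift_in_trivialization by blast
qed

end
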